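(* For every PTime relational machine $\Xi$ (with input vocabulary $\Upsilon_0$), there exists a PTime ASM program $\bar\Pi$ with input vocabulary $\Upsilon_0$ that accepts all input structures accepted by $\Xi$ and rejects all input structures rejected by $\Xi$.
   Context: RELATIONAL MACHINES. A relational machine is a Turing machine augmented with a relational store, which is a structure of a fixed finite purely relational vocabulary $\Upsilon$; a part $\Upsilon_0\subseteq\Upsilon$ is devoted to the input relations (the input is a finite $\Upsilon_0$-structure). The Turing tape is initially empty. The program consists of "if condition then action" instructions, which are ordinary Turing instructions except that (1) the condition may be augmented with the emptiness test of one of the relations, and (2) the action may be augmented with an algebraic operation on the relations whose result is assigned to a relation of the store: Boolean operations; projections $\pi_{i_1\dots i_m}R_k$ (project $R_k$ on the listed coordinates in the specified order); Cartesian product of two relations; selections $\sigma_{i=j}R_k$ (select the tuples of $R_k$ whose $i$-th and $j$-th components coincide). Arities are assumed appropriate. A PTime relational machine is a relational machine $M$ together with a polynomial $p(n)$; it accepts (rejects) an input structure $I$ of size $n$ if $M$ accepts (rejects) $I$ within $p(n)$ computation steps (it may do neither). ASM MODEL. "Object" means an atom (a non-set) or a set. For a finite set $X$ of atoms, $\mathrm{HF}(X)$ is the smallest set $Y$ such that $X\subseteq Y$ and every finite subset of $Y$ is a member of $Y$. $\mathrm{TC}(x)$ is the least transitive set $Y$ with $x\in Y$. Natural numbers are von Neumann ordinals; $\mathit{false}=0=\emptyset$, $\mathit{true}=1=\{\emptyset\}$. Vocabulary: finitely many function names with arities (some marked relational, called predicates), consisting of: static logic predicates ($=$, nullary $\mathit{true},\mathit{false}$,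 Boolean connectives); static set-theoretic names (binary predicate $\in$; nullary $\emptyset$, $\mathrm{Atoms}$; unary $\bigcup$, $\mathrm{TheUnique}$; binary $\mathrm{Pair}$); finitely many static input predicates; finitely many dynamic names, including nullary predicates $\mathrm{Halt}$ and $\mathrm{Output}$. State: a structure with base set $\mathrm{HF}(X)$, $X$ a finite set of atoms. Predicates take values in $\{0,1\}$; Boolean connectives are as usual on $\{0,1\}$ and $0$ if some argument is not Boolean; $\in,\emptyset$ are standard; $\mathrm{Atoms}=X$; $\bigcup a$ is the union of those elements of $a$ that are sets ($\emptyset$ if $a$ is an atom); $\mathrm{TheUnique}(a)$ is the unique element of $a$ if $a$ is a singleton and $\emptyset$ otherwise; $\mathrm{Pair}(a,b)=\{a,b\}$; input predicates hold only of tuples of atoms; for each dynamic $f$ of arity $j$ the set $\mathrm{Extent}(f)=\{(x_0,\dots,x_j): f(x_0,\dots,x_{j-1})=x_j\neq 0\}$ is finite. An input structure is a finite structure of the input vocabulary (replaced by an isomorphic copy whose elements are atoms); it determines the initial state whose atoms with the input predicates form that structure and in which all dynamic functions have empty extent. Terms: variables; $f(t_1,\dots,t_j)$ (Boolean if $f$ is a predicate); $\{t(v):v\in r:g(v)\}$ with $r$ a term without $v$ free and $g$ a Boolean term ($v$ becomes bound), whose value is the set of values of $t(v)$ for those $v\in r$ with $g(v)$ true. Rules: Skip; $f(t_1,\dots,t_j):=t_0$ with $f$ dynamic ($t_0$ Boolean if $f$ is relational); "if $g$ then $R_1$ else $R_2$ endif" with $g$ a Boolean term; "do forall $v\in r$,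 $R_0(v)$ enddo" with $r$ a term without $v$ free ($v$ becomes bound). An expanded state is a state with an assignment of values to finitely many variables; $A(v\mapsto a)$ is $A$ with $v$ (re)assigned $a$. $\mathrm{Den}(R,A)$ is a set of updates $(f,\bar a,b)$: $\mathrm{Den}(\text{Skip},A)=\emptyset$; for $f(\bar s):=t$ it is $\{(f,\mathrm{Val}_A(\bar s),\mathrm{Val}_A(t))\}$; for a conditional it is $\mathrm{Den}(R_1,A)$ or $\mathrm{Den}(R_2,A)$ according as $g$ is true or not in $A$; for do-forall it is $\bigcup\{\mathrm{Den}(R_0(v),A(v\mapsto a)):a\in\mathrm{Val}_A(r)\}$. The sequel of $A$ with respect to $R$ is obtained by simultaneously setting $f(\bar a)=b$ for all $(f,\bar a,b)\in\mathrm{Den}(R,A)$ if no two updates clash (same $(f,\bar a)$, different $b$); otherwise it is the state $A$ itself. A program is a rule without free variables. The run of a program $\Pi$ on an input structure $I$ is the finite or infinite sequence $A_0,A_1,\dots$ with $A_0$ the initial state of $I$ and each $A_{i+1}$ the sequel of $A_i$ with respect to $\Pi$, which stops at the first state in which $\mathrm{Halt}$ holds (and is infinite if there is none). The length of a finite run $\langle A_i:i\le l\rangle$ is $l$. PTIME PROGRAMS. An object is critical at a state if it is an atom, or $0$ or $1$, or a value of a dynamic function, or a component of a location (argument tuple) where some dynamic function takes a value different from $\emptyset$. It is active at a state if it belongs to $\mathrm{TC}(y)$ for some critical $y$, and active in a run if active at some state of the run. A PTime (ASM) program is $\bar\Pi=(\Pi,p(n),q(n))$ with $\Pi$ a program and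 $p,q$ integer polynomials; its run on an input structure $I$ of size $n$ is the longest initial segment of the run of $\Pi$ on $I$ that has length $\le p(n)$ and at most $q(n)$ active objects. $\bar\Pi$ accepts (rejects) $I$ if this run halts (i.e. $\mathrm{Halt}$ holds in its final state) and $\mathrm{Output}$ is true (false) in the final state. *)

theory Defs
  imports
    Main
    "HOL-Library.FSet"
    "HOL-Computational_Algebra.Polynomial"
begin

section \<open>Vocabularies and finite structures\<close>

text \<open>
  A relational vocabulary is a finite map from relation names to arities. The elements of a
  structure have an arbitrary type \<open>'a\<close> and serve directly as the atoms of ASM states. Neither
  machines nor programs mention \<open>'a\<close>; since every finite structure has an isomorphic copy inside
  any infinite type, an infinite \<open>'a\<close> already accounts for all finite structures.
\<close>

type_synonym 'r vocab = "'r \<rightharpoonup> nat"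

record ('r, 'a) struct =
  universe :: "'a set"
  rel :: "'r \<Rightarrow> 'a list set"

definition tuples :: "'a set \<Rightarrow> nat \<Rightarrow> 'a list set" where
  "tuples U k = {xs. length xs = k \<and> set xs \<subseteq> U}"

text \<open>Values of \<open>rel\<close> at names outside the vocabulary are junk and are never consulted.\<close>

definition finite_structure :: "'r vocab \<Rightarrow> ('r, 'a) struct \<Rightarrow> bool" where
  "finite_structure \<Upsilon> I \<longleftrightarrow>
     finite (universe I) \<and> (\<forall>r k. \<Upsilon> r = Some k \<longrightarrow> rel I r \<subseteq> tuples (universe I) k)"

definition size_of :: "('r, 'a) struct \<Rightarrow> nat" where
  "size_of I = card (universe I)"


section \<open>Relational machines\<close>

text \<open>Coordinates in projections and selections are counted from 0.\<close>

datatype 'r relop =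
    UnionOp 'r 'r
  | InterOp 'r 'r
  | DiffOp 'r 'r
  | ComplOp 'r
  | ProjOp "nat list" 'r
  | ProdOp 'r 'r
  | SelectOp nat nat 'r

text \<open>\<open>op_ok \<Upsilon> k e\<close>: all arities are appropriate for assigning the result of \<open>e\<close> to \<open>k\<close>.\<close>

fun op_ok :: "'r vocab \<Rightarrow> 'r \<Rightarrow> 'r relop \<Rightarrow> bool" where
  "op_ok \<Upsilon> k (UnionOp i j) \<longleftrightarrow> k \<in> dom \<Upsilon> \<and> \<Upsilon> i = \<Upsilon> k \<and> \<Upsilon> j = \<Upsilon> k"
| "op_ok \<Upsilon> k (InterOp i j) \<longleftrightarrow> k \<in> dom \<Upsilon> \<and> \<Upsilon> i = \<Upsilon> k \<and> \<Upsilon> j = \<Upsilon> k"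
| "op_ok \<Upsilon> k (DiffOp i j) \<longleftrightarrow> k \<in> dom \<Upsilon> \<and> \<Upsilon> i = \<Upsilon> k \<and> \<Upsilon> j = \<Upsilon> k"
| "op_ok \<Upsilon> k (ComplOp i) \<longleftrightarrow> k \<in> dom \<Upsilon> \<and> \<Upsilon> i = \<Upsilon> k"
| "op_ok \<Upsilon> k (ProjOp cs i) \<longleftrightarrow>
     (\<exists>a. \<Upsilon> i = Some a \<and> (\<forall>c \<in> set cs. c < a) \<and> \<Upsilon> k = Some (length cs))"
| "op_ok \<Upsilon> k (ProdOp i j) \<longleftrightarrow> (\<exists>a b. \<Upsilon> i = Some a \<and> \<Upsilon> j = Some b \<and> \<Upsilon> k = Some (a + b))"
| "op_ok \<Upsilon> k (SelectOp c d i) \<longleftrightarrow> (\<exists>a. \<Upsilon> i = Some a \<and> c < a \<and> d < a \<and> \<Upsilon> k = Some a)"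

fun op_val :: "'r vocab \<Rightarrow> ('r, 'a) struct \<Rightarrow> 'r relop \<Rightarrow> 'a list set" where
  "op_val \<Upsilon> B (UnionOp i j) = rel B i \<union> rel B j"
| "op_val \<Upsilon> B (InterOp i j) = rel B i \<inter> rel B j"
| "op_val \<Upsilon> B (DiffOp i j) = rel B i - rel B j"
| "op_val \<Upsilon> B (ComplOp i) = tuples (universe B) (the (\<Upsilon> i)) - rel B i"
| "op_val \<Upsilon> B (ProjOp cs i) = {map (\<lambda>c. xs ! c) cs | xs. xs \<in> rel B i}"
| "op_val \<Upsilon> B (ProdOp i j) = {xs @ ys | xs ys. xs \<in> rel B i \<and> ys \<in> rel B j}"
| "op_val \<Upsilon> B (SelectOp c d i) = {xs \<in> rel B i. xs ! c = xs ! d}"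

datatype move = MoveLeft | Stay | MoveRight

fun offset :: "move \<Rightarrow> int" where
  "offset MoveLeft = -1"
| "offset Stay = 0"
| "offset MoveRight = 1"

text \<open>
  The test \<open>Some (r, True)\<close> asks that \<open>r\<close> be empty, \<open>Some (r, False)\<close> that it be nonempty.
  The operation \<open>Some (k, e)\<close> assigns the value of \<open>e\<close> to \<open>k\<close>.
\<close>

record 'r instr =
  in_ctrl :: nat
  in_sym :: nat
  in_test :: "('r \<times> bool) option"
  out_ctrl :: nat
  out_sym :: nat
  out_move :: move
  out_op :: "('r \<times> 'r relop) option"

record 'r rel_machine =
  rm_vocab :: "'r vocab"
  rm_instrs :: "'r instr set"
  rm_init :: nat
  rm_blank :: nat
  rm_acc :: "nat set"
  rm_rej :: "nat set"

text \<open>The last argument tells which relations of the store are empty.\<close>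

definition enabled :: "'r instr \<Rightarrow> nat \<Rightarrow> nat \<Rightarrow> ('r \<Rightarrow> bool) \<Rightarrow> bool" where
  "enabled i q s E \<longleftrightarrow> in_ctrl i = q \<and> in_sym i = s \<and>
     (case in_test i of None \<Rightarrow> True | Some (r, b) \<Rightarrow> E r = b)"

definition instr_ok :: "'r vocab \<Rightarrow> 'r instr \<Rightarrow> bool" where
  "instr_ok \<Upsilon> i \<longleftrightarrow>
     (case in_test i of None \<Rightarrow> True | Some (r, b) \<Rightarrow> r \<in> dom \<Upsilon>) \<and>
     (case out_op i of None \<Rightarrow> True | Some (k, e) \<Rightarrow> op_ok \<Upsilon> k e)"

definition deterministic :: "'r instr set \<Rightarrow> bool" where
  "deterministic P \<longleftrightarrow>
     (\<forall>q s E. \<forall>i \<in> P. \<forall>j \<in> P. enabled i q s E \<and> enabled j q s E \<longrightarrow> i = j)"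

definition relational_machine :: "'r vocab \<Rightarrow> 'r rel_machine \<Rightarrow> bool" where
  "relational_machine \<Upsilon>0 M \<longleftrightarrow>
     finite (dom (rm_vocab M)) \<and> \<Upsilon>0 \<subseteq>\<^sub>m rm_vocab M \<and>
     finite (rm_instrs M) \<and> (\<forall>i \<in> rm_instrs M. instr_ok (rm_vocab M) i) \<and>
     deterministic (rm_instrs M) \<and>
     finite (rm_acc M) \<and> finite (rm_rej M) \<and> rm_acc M \<inter> rm_rej M = {}"

record ('r, 'a) rm_config =
  ctrl :: nat
  tape :: "int \<Rightarrow> nat"
  head :: int
  store :: "('r, 'a) struct"

definition rm_start :: "'r vocab \<Rightarrow> 'r rel_machine \<Rightarrow> ('r, 'a) struct \<Rightarrow> ('r, 'a) rm_config" where
  "rm_start \<Upsilon>0 M I =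
     \<lparr>ctrl = rm_init M, tape = (\<lambda>_. rm_blank M), head = 0,
      store = \<lparr>universe = universe I, rel = (\<lambda>r. if r \<in> dom \<Upsilon>0 then rel I r else {})\<rparr>\<rparr>"

definition rm_store_update ::
    "'r vocab \<Rightarrow> ('r \<times> 'r relop) option \<Rightarrow> ('r, 'a) struct \<Rightarrow> ('r, 'a) struct" where
  "rm_store_update \<Upsilon> a B =
     (case a of None \<Rightarrow> B | Some (k, e) \<Rightarrow> B\<lparr>rel := (rel B)(k := op_val \<Upsilon> B e)\<rparr>)"

definition rm_fire ::
    "'r vocab \<Rightarrow> 'r instr \<Rightarrow> ('r, 'a) rm_config \<Rightarrow> ('r, 'a) rm_config" where
  "rm_fire \<Upsilon> i c =
     \<lparr>ctrl = out_ctrl i, tape = (tape c)(head c := out_sym i), head = head c + offset (out_move i),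
      store = rm_store_update \<Upsilon> (out_op i) (store c)\<rparr>"

definition rm_step :: "'r rel_machine \<Rightarrow> ('r, 'a) rm_config \<Rightarrow> ('r, 'a) rm_config \<Rightarrow> bool" where
  "rm_step M c c' \<longleftrightarrow> ctrl c \<notin> rm_acc M \<union> rm_rej M \<and>
     (\<exists>i \<in> rm_instrs M.
        enabled i (ctrl c) (tape c (head c)) (\<lambda>r. rel (store c) r = {}) \<and>
        c' = rm_fire (rm_vocab M) i c)"

record 'r ptime_rm =
  prm_machine :: "'r rel_machine"
  prm_bound :: "int poly"

definition ptime_relational_machine :: "'r vocab \<Rightarrow> 'r ptime_rm \<Rightarrow> bool" where
  "ptime_relational_machine \<Upsilon>0 \<Xi> \<longleftrightarrow> relational_machine \<Upsilon>0 (prm_machine \<Xi>)"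

definition rm_accepts :: "'r vocab \<Rightarrow> 'r ptime_rm \<Rightarrow> ('r, 'a) struct \<Rightarrow> bool" where
  "rm_accepts \<Upsilon>0 \<Xi> I \<longleftrightarrow>
     (\<exists>t c. int t \<le> poly (prm_bound \<Xi>) (int (size_of I)) \<and>
        (rm_step (prm_machine \<Xi>) ^^ t) (rm_start \<Upsilon>0 (prm_machine \<Xi>) I) c \<and>
        ctrl c \<in> rm_acc (prm_machine \<Xi>))"

definition rm_rejects :: "'r vocab \<Rightarrow> 'r ptime_rm \<Rightarrow> ('r, 'a) struct \<Rightarrow> bool" where
  "rm_rejects \<Upsilon>0 \<Xi> I \<longleftrightarrow>
     (\<exists>t c. int t \<le> poly (prm_bound \<Xi>) (int (size_of I)) \<and>
        (rm_step (prm_machine \<Xi>) ^^ t) (rm_start \<Upsilon>0 (prm_machine \<Xi>) I) c \<and>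
        ctrl c \<in> rm_rej (prm_machine \<Xi>))"


section \<open>Hereditarily finite objects\<close>

text \<open>
  Every object over atoms in \<open>'a\<close> is an element of \<open>HF UNIV\<close>; extensionality of sets is built
  into the datatype.
\<close>

datatype 'a obj = Atom 'a | HSet "'a obj fset"

fun elems :: "'a obj \<Rightarrow> 'a obj fset" where
  "elems (Atom a) = {||}"
| "elems (HSet Z) = Z"

inductive_set HF :: "'a set \<Rightarrow> 'a obj set" for X :: "'a set" where
  HF_atom: "a \<in> X \<Longrightarrow> Atom a \<in> HF X"
| HF_set: "(\<And>z. z |\<in>| Z \<Longrightarrow> z \<in> HF X) \<Longrightarrow> HSet Z \<in> HF X"

inductive_set TC :: "'a obj \<Rightarrow> 'a obj set" for x :: "'a obj" where
  TC_self: "x \<in> TC x"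
| TC_elem: "y \<in> TC x \<Longrightarrow> z |\<in>| elems y \<Longrightarrow> z \<in> TC x"

definition zero :: "'a obj" where
  "zero = HSet {||}"

definition one :: "'a obj" where
  "one = HSet {|zero|}"

definition truth :: "bool \<Rightarrow> 'a obj" where
  "truth b = (if b then one else zero)"


section \<open>ASM vocabularies and states\<close>

datatype dyn_name = Halt | Output | Dyn nat

record 'r asm_vocab =
  input_arity :: "'r vocab"
  dyn_arity :: "dyn_name \<rightharpoonup> nat"
  dyn_preds :: "dyn_name set"

definition vocab_ok :: "'r asm_vocab \<Rightarrow> bool" where
  "vocab_ok V \<longleftrightarrow>
     finite (dom (input_arity V)) \<and> finite (dom (dyn_arity V)) \<and>
     dyn_preds V \<subseteq> dom (dyn_arity V) \<and> {Halt, Output} \<subseteq> dyn_preds V \<and>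
     dyn_arity V Halt = Some 0 \<and> dyn_arity V Output = Some 0"

datatype 'r fn_name =
    EqF | TrueF | FalseF | NotF | AndF | OrF
  | InF | EmptyF | AtomsF | BigUnionF | TheUniqueF | PairF
  | InputF 'r
  | DynF dyn_name

fun fn_arity :: "'r asm_vocab \<Rightarrow> 'r fn_name \<Rightarrow> nat option" where
  "fn_arity V EqF = Some 2"
| "fn_arity V TrueF = Some 0"
| "fn_arity V FalseF = Some 0"
| "fn_arity V NotF = Some 1"
| "fn_arity V AndF = Some 2"
| "fn_arity V OrF = Some 2"
| "fn_arity V InF = Some 2"
| "fn_arity V EmptyF = Some 0"
| "fn_arity V AtomsF = Some 0"
| "fn_arity V BigUnionF = Some 1"
| "fn_arity V TheUniqueF = Some 1"
| "fn_arity V PairF = Some 2"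
| "fn_arity V (InputF r) = input_arity V r"
| "fn_arity V (DynF f) = dyn_arity V f"

fun is_pred :: "'r asm_vocab \<Rightarrow> 'r fn_name \<Rightarrow> bool" where
  "is_pred V (InputF r) \<longleftrightarrow> True"
| "is_pred V (DynF f) \<longleftrightarrow> f \<in> dyn_preds V"
| "is_pred V f \<longleftrightarrow> f \<in> {EqF, TrueF, FalseF, NotF, AndF, OrF, InF}"

text \<open>
  The universe of a state is its set of atoms; the base set is \<open>HF\<close> of it. The component \<open>rel\<close>
  interprets the input predicates.
\<close>

record ('r, 'a) asm_state = "('r, 'a) struct" +
  dyn :: "dyn_name \<Rightarrow> 'a obj list \<Rightarrow> 'a obj"

text \<open>The final clause is reached only by argument lists of the wrong length.\<close>

fun fn_val :: "('r, 'a) asm_state \<Rightarrow> 'r fn_name \<Rightarrow> 'a obj list \<Rightarrow> 'a obj" where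
  "fn_val A EqF [x, y] = truth (x = y)"
| "fn_val A TrueF [] = one"
| "fn_val A FalseF [] = zero"
| "fn_val A NotF [x] = truth (x = zero)"
| "fn_val A AndF [x, y] = truth (x = one \<and> y = one)"
| "fn_val A OrF [x, y] = truth (x \<in> {zero, one} \<and> y \<in> {zero, one} \<and> (x = one \<or> y = one))"
| "fn_val A InF [x, y] = truth (x |\<in>| elems y)"
| "fn_val A EmptyF [] = HSet {||}"
| "fn_val A AtomsF [] = HSet (Abs_fset (Atom ` universe A))"
| "fn_val A BigUnionF [x] = HSet (ffUnion (elems |`| elems x))"
| "fn_val A TheUniqueF [x] = (if \<exists>y. x = HSet {|y|} then THE y. x = HSet {|y|} else HSet {||})"
| "fn_val A PairF [x, y] = HSet {|x, y|}"
| "fn_val A (InputF r) xs = truth (\<exists>as. xs = map Atom as \<and> as \<in> rel A r)"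
| "fn_val A (DynF f) xs = dyn A f xs"
| "fn_val A _ _ = zero"

definition holds :: "('r, 'a) asm_state \<Rightarrow> dyn_name \<Rightarrow> bool" where
  "holds A f \<longleftrightarrow> dyn A f [] = one"

definition initial_state :: "('r, 'a) struct \<Rightarrow> ('r, 'a) asm_state" where
  "initial_state I = \<lparr>universe = universe I, rel = rel I, dyn = (\<lambda>_ _. zero)\<rparr>"


section \<open>Terms, rules and their semantics\<close>

text \<open>\<open>Compr t v r g\<close> is the term \<open>{t(v) : v \<in> r : g(v)}\<close>.\<close>

datatype 'r aterm =
    Var nat
  | App "'r fn_name" "'r aterm list"
  | Compr "'r aterm" nat "'r aterm" "'r aterm"

datatype 'r arule =
    Skip
  | Assign dyn_name "'r aterm list" "'r aterm"
  | Cond "'r aterm" "'r arule" "'r arule"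
  | Forall nat "'r aterm" "'r arule"

fun fv_term :: "'r aterm \<Rightarrow> nat set" where
  "fv_term (Var v) = {v}"
| "fv_term (App f ts) = (\<Union>t \<in> set ts. fv_term t)"
| "fv_term (Compr t v r g) = fv_term r \<union> ((fv_term t \<union> fv_term g) - {v})"

fun fv_rule :: "'r arule \<Rightarrow> nat set" where
  "fv_rule Skip = {}"
| "fv_rule (Assign f ts t) = (\<Union>s \<in> set ts. fv_term s) \<union> fv_term t"
| "fv_rule (Cond g R1 R2) = fv_term g \<union> fv_rule R1 \<union> fv_rule R2"
| "fv_rule (Forall v r R) = fv_term r \<union> (fv_rule R - {v})"

fun boolean_term :: "'r asm_vocab \<Rightarrow> 'r aterm \<Rightarrow> bool" where
  "boolean_term V (App f ts) \<longleftrightarrow> is_pred V f"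
| "boolean_term V _ \<longleftrightarrow> False"

fun term_ok :: "'r asm_vocab \<Rightarrow> 'r aterm \<Rightarrow> bool" where
  "term_ok V (Var v) \<longleftrightarrow> True"
| "term_ok V (App f ts) \<longleftrightarrow> fn_arity V f = Some (length ts) \<and> (\<forall>t \<in> set ts. term_ok V t)"
| "term_ok V (Compr t v r g) \<longleftrightarrow>
     term_ok V t \<and> term_ok V r \<and> term_ok V g \<and> boolean_term V g \<and> v \<notin> fv_term r"

fun rule_ok :: "'r asm_vocab \<Rightarrow> 'r arule \<Rightarrow> bool" where
  "rule_ok V Skip \<longleftrightarrow> True"
| "rule_ok V (Assign f ts t) \<longleftrightarrow>
     dyn_arity V f = Some (length ts) \<and> (\<forall>s \<in> set ts. term_ok V s) \<and> term_ok V t \<and>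
     (f \<in> dyn_preds V \<longrightarrow> boolean_term V t)"
| "rule_ok V (Cond g R1 R2) \<longleftrightarrow>
     term_ok V g \<and> boolean_term V g \<and> rule_ok V R1 \<and> rule_ok V R2"
| "rule_ok V (Forall v r R) \<longleftrightarrow> term_ok V r \<and> v \<notin> fv_term r \<and> rule_ok V R"

definition program :: "'r asm_vocab \<Rightarrow> 'r arule \<Rightarrow> bool" where
  "program V R \<longleftrightarrow> rule_ok V R \<and> fv_rule R = {}"

text \<open>
  Assignments are total; the values of variables that are not free in the term or rule are
  irrelevant.
\<close>

fun val :: "('r, 'a) asm_state \<Rightarrow> (nat \<Rightarrow> 'a obj) \<Rightarrow> 'r aterm \<Rightarrow> 'a obj" where
  "val A e (Var v) = e v"
| "val A e (App f ts) = fn_val A f (map (val A e) ts)"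
| "val A e (Compr t v r g) =
     HSet ((\<lambda>a. val A (e(v := a)) t) |`|
           ffilter (\<lambda>a. val A (e(v := a)) g = one) (elems (val A e r)))"

fun den :: "'r arule \<Rightarrow> ('r, 'a) asm_state \<Rightarrow> (nat \<Rightarrow> 'a obj) \<Rightarrow>
    (dyn_name \<times> 'a obj list \<times> 'a obj) set" where
  "den Skip A e = {}"
| "den (Assign f ts t) A e = {(f, map (val A e) ts, val A e t)}"
| "den (Cond g R1 R2) A e = (if val A e g = one then den R1 A e else den R2 A e)"
| "den (Forall v r R) A e = (\<Union>a \<in> fset (elems (val A e r)). den R A (e(v := a)))"

definition consistent :: "(dyn_name \<times> 'a obj list \<times> 'a obj) set \<Rightarrow> bool" where
  "consistent D \<longleftrightarrow> (\<forall>f xs b c. (f, xs, b) \<in> D \<and> (f, xs, c) \<in> D \<longrightarrow> b = c)"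

definition fire ::
    "(dyn_name \<times> 'a obj list \<times> 'a obj) set \<Rightarrow> ('r, 'a) asm_state \<Rightarrow> ('r, 'a) asm_state" where
  "fire D A = A\<lparr>dyn := (\<lambda>f xs. if \<exists>b. (f, xs, b) \<in> D then THE b. (f, xs, b) \<in> D else dyn A f xs)\<rparr>"

definition sequel :: "'r arule \<Rightarrow> ('r, 'a) asm_state \<Rightarrow> ('r, 'a) asm_state" where
  "sequel R A =
     (let D = den R A (\<lambda>_. zero) in if consistent D then fire D A else A)"


section \<open>Runs of PTime programs\<close>

definition state_at :: "'r arule \<Rightarrow> ('r, 'a) struct \<Rightarrow> nat \<Rightarrow> ('r, 'a) asm_state" where
  "state_at R I i = (sequel R ^^ i) (initial_state I)"

text \<open>
  The states \<open>state_at R I 0, \<dots>, state_at R I l\<close> form an initial segment, of length \<open>l\<close>, of the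
  run, which stops at the first state where \<open>Halt\<close> holds.
\<close>

definition run_segment :: "'r arule \<Rightarrow> ('r, 'a) struct \<Rightarrow> nat \<Rightarrow> bool" where
  "run_segment R I l \<longleftrightarrow> (\<forall>i < l. \<not> holds (state_at R I i) Halt)"

definition locations :: "'r asm_vocab \<Rightarrow> ('r, 'a) asm_state \<Rightarrow> (dyn_name \<times> 'a obj list) set" where
  "locations V A =
     {(f, xs). dyn_arity V f = Some (length xs) \<and> set xs \<subseteq> HF (universe A)}"

definition critical :: "'r asm_vocab \<Rightarrow> ('r, 'a) asm_state \<Rightarrow> 'a obj set" where
  "critical V A =
     Atom ` universe A \<union> {zero, one} \<union>
     {dyn A f xs | f xs. (f, xs) \<in> locations V A} \<union>
     (\<Union>{set xs | f xs. (f, xs) \<in> locations V A \<and> dyn A f xs \<noteq> zero})"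

definition active :: "'r asm_vocab \<Rightarrow> ('r, 'a) asm_state \<Rightarrow> 'a obj set" where
  "active V A = (\<Union>y \<in> critical V A. TC y)"

record 'r ptime_asm =
  pa_vocab :: "'r asm_vocab"
  pa_prog :: "'r arule"
  pa_steps :: "int poly"
  pa_space :: "int poly"

definition ptime_program :: "'r vocab \<Rightarrow> 'r ptime_asm \<Rightarrow> bool" where
  "ptime_program \<Upsilon>0 P \<longleftrightarrow>
     vocab_ok (pa_vocab P) \<and> input_arity (pa_vocab P) = \<Upsilon>0 \<and> program (pa_vocab P) (pa_prog P)"

definition bounded_segment :: "'r ptime_asm \<Rightarrow> ('r, 'a) struct \<Rightarrow> nat \<Rightarrow> bool" where
  "bounded_segment P I l \<longleftrightarrow>
     run_segment (pa_prog P) I l \<and>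
     int l \<le> poly (pa_steps P) (int (size_of I)) \<and>
     (let Act = (\<Union>i \<le> l. active (pa_vocab P) (state_at (pa_prog P) I i)) in
        finite Act \<and> int (card Act) \<le> poly (pa_space P) (int (size_of I)))"

text \<open>\<open>ptime_run P I l\<close>: the run of \<open>P\<close> on \<open>I\<close> ends with the state of index \<open>l\<close>.\<close>

definition ptime_run :: "'r ptime_asm \<Rightarrow> ('r, 'a) struct \<Rightarrow> nat \<Rightarrow> bool" where
  "ptime_run P I l \<longleftrightarrow> bounded_segment P I l \<and> (\<forall>m. bounded_segment P I m \<longrightarrow> m \<le> l)"

definition asm_accepts :: "'r ptime_asm \<Rightarrow> ('r, 'a) struct \<Rightarrow> bool" where
  "asm_accepts P I \<longleftrightarrow>
     (\<exists>l. ptime_run P I l \<and> holds (state_at (pa_prog P) I l) Halt \<and>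
        holds (state_at (pa_prog P) I l) Output)"

definition asm_rejects :: "'r ptime_asm \<Rightarrow> ('r, 'a) struct \<Rightarrow> bool" where
  "asm_rejects P I \<longleftrightarrow>
     (\<exists>l. ptime_run P I l \<and> holds (state_at (pa_prog P) I l) Halt \<and>
        \<not> holds (state_at (pa_prog P) I l) Output)"

end

theory Submission
  imports Defs
begin

text \<open>
  One step of the program simulates one step of the machine, and one more step halts. Control
  states, tape symbols and head positions are coded by numerals whose successor is
  \<open>x \<mapsto> {x}\<close>, so that \<open>Pair(x, x)\<close> increments and \<open>TheUnique(x)\<close> decrements. The head position
  \<open>h\<close> is the pair \<open>(max h 0, max (-h) 0)\<close>, and the tape is a binary dynamic function on such pairs.
  A relation of the store is a dynamic function with values 0 and 1 on tuples of atoms, and the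
  algebraic operations are first-order definable. The active objects are then the atoms and the
  numerals up to the running time plus a constant.
\<close>

section \<open>Objects\<close>

text \<open>The rule language has no parallel composition, no quantifiers and no initialization; the
  derived terms and rules supply the first two, the choice of codes the third. A do-forall over the
  two truth values fires two rules at once, and an existential quantifier over the atoms becomes the
  question whether a comprehension of the constant 0 contains 0. Because relations are functions on
  tuples rather than sets of tuples, no tuple is itself an object: only its components are critical,
  so the number of active objects is linear in input size and running time, whatever the arities.
  The transitive closure of a numeral adds only smaller numerals, and after t steps the head is at
  distance at most t from the origin. The tape is infinite in both directions while numerals code
  only nonnegative numbers; hence the pair of counters. The resource bounds are proved along runs
  that reach a decision in time, the only runs about which the claim speaks.\<close>

lemma truth_simps [simp]:
  "truth b = one \<longleftrightarrow> b" "truth b = zero \<longleftrightarrow> \<not> b"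
  "one = truth b \<longleftrightarrow> b" "zero = truth b \<longleftrightarrow> \<not> b"
  "truth b = truth c \<longleftrightarrow> b = c" "(one :: 'a obj) \<noteq> zero" "(zero :: 'a obj) \<noteq> one"
  by (auto simp: truth_def one_def zero_def)

primrec num :: "nat \<Rightarrow> 'a obj" where
  "num 0 = zero"
| "num (Suc n) = HSet {|num n|}"

lemma num_eq_iff [simp]: "num m = num n \<longleftrightarrow> m = n"
proof (induction m arbitrary: n)
  case 0
  show ?case by (cases n) (auto simp: zero_def)
next
  case (Suc m)
  then show ?case by (cases n) (auto simp: zero_def)
qed

lemma num_eq_zero_iff [simp]: "num m = zero \<longleftrightarrow> m = 0"
  using num_eq_iff[of m 0] by simp

text \<open>The Booleans are the first two numerals, so they fit into any numeral bound that is at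
  least 1.\<close>

lemma truth_eq_num: "truth b = num (if b then 1 else 0)"
  by (simp add: truth_def one_def)

text \<open>The superset used to count active objects: linear in size, and transitive because the
  only element of \<open>num (Suc k)\<close> is \<open>num k\<close>.\<close>

definition small_objs :: "'a set \<Rightarrow> nat \<Rightarrow> 'a obj set" where
  "small_objs U m = Atom ` U \<union> num ` {..m}"

lemma num_in_small_objs [intro]: "k \<le> m \<Longrightarrow> num k \<in> small_objs U m"
  by (simp add: small_objs_def)

lemma zero_in_small_objs [simp]: "zero \<in> small_objs U m"
  using num_in_small_objs[of 0 m U] by simp

lemma Atom_in_small_objs [intro]: "a \<in> U \<Longrightarrow> Atom a \<in> small_objs U m"
  by (simp add: small_objs_def)

lemma truth_in_small_objs: "1 \<le> m \<Longrightarrow> truth b \<in> small_objs U m"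
  by (cases b) (auto simp: truth_eq_num simp del: num.simps)

lemma small_objs_mono: "m \<le> m' \<Longrightarrow> small_objs U m \<subseteq> small_objs U m'"
  by (auto simp: small_objs_def)

lemma finite_small_objs: "finite U \<Longrightarrow> finite (small_objs U m)"
  by (simp add: small_objs_def)

lemma card_small_objs:
  assumes "finite U"
  shows "card (small_objs U m) \<le> card U + Suc m"
proof -
  have "card (small_objs U m) \<le> card (Atom ` U) + card ((num :: nat \<Rightarrow> 'a obj) ` {..m})"
    unfolding small_objs_def by (rule card_Un_le)
  also have "\<dots> \<le> card U + card {..m}"
    using assms by (intro add_mono card_image_le) auto
  finally show ?thesis by simp
qed

lemma TC_small_objs:
  assumes "x \<in> small_objs U m"
  shows "TC x \<subseteq> small_objs U m"
proof
  fix y assume "y \<in> TC x"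
  then show "y \<in> small_objs U m"
  proof induction
    case TC_self
    show ?case by (fact assms)
  next
    case (TC_elem y z)
    then consider a where "y = Atom a" | k where "y = num k" "k \<le> m"
      by (auto simp: small_objs_def)
    then show ?case
    proof cases
      case 1
      then show ?thesis using TC_elem by simp
    next
      case 2
      then show ?thesis using TC_elem by (cases k) (auto simp: zero_def)
    qed
  qed
qed

lemma fset_Abs_Atoms [simp]: "finite U \<Longrightarrow> fset (Abs_fset (Atom ` U)) = Atom ` U"
  by (simp add: Abs_fset_inverse)

section \<open>Derived terms and rules\<close>

lemma val_cong: "(\<And>x. x \<in> fv_term t \<Longrightarrow> e x = e' x) \<Longrightarrow> val A e t = val A e' t"
proof (induction t arbitrary: e e')
  case (Compr t v r g)
  have "val A (e(v := a)) t = val A (e'(v := a)) t" for a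
    by (rule Compr.IH(1)) (use Compr.prems in auto)
  moreover have "val A (e(v := a)) g = val A (e'(v := a)) g" for a
    by (rule Compr.IH(3)) (use Compr.prems in auto)
  moreover have "val A e r = val A e' r"
    by (rule Compr.IH(2)) (use Compr.prems in auto)
  ultimately show ?case by simp
next
  case (App f ts)
  have "map (val A e) ts = map (val A e') ts"
    by (rule map_cong[OF refl], rule App.IH) (use App.prems in auto)
  then show ?case by (simp del: map_eq_conv)
qed auto

lemma den_cong: "(\<And>x. x \<in> fv_rule R \<Longrightarrow> e x = e' x) \<Longrightarrow> den R A e = den R A e'"
proof (induction R arbitrary: e e')
  case (Assign f ts t)
  then have "map (val A e) ts = map (val A e') ts" "val A e t = val A e' t"
    by (auto intro!: map_cong val_cong)
  then show ?case by (simp del: map_eq_conv)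
next
  case (Cond g R1 R2)
  then have "val A e g = val A e' g" by (auto intro!: val_cong)
  moreover have "den R1 A e = den R1 A e'" by (rule Cond.IH) (use Cond.prems in auto)
  moreover have "den R2 A e = den R2 A e'" by (rule Cond.IH) (use Cond.prems in auto)
  ultimately show ?case by simp
next
  case (Forall v r R)
  then have "val A e r = val A e' r" by (auto intro!: val_cong)
  moreover have "den R A (e(v := a)) = den R A (e'(v := a))" for a
    by (rule Forall.IH) (use Forall.prems in auto)
  ultimately show ?case by simp
qed simp

section \<open>Parallel composition and case distinction\<close>

definition par :: "'r arule \<Rightarrow> 'r arule \<Rightarrow> 'r arule" where
  "par R1 R2 = Forall 0 (App PairF [App FalseF [], App TrueF []])
     (Cond (App EqF [Var 0, App FalseF []]) R1 R2)"

text \<open>The bound variable ranges over \<open>zero\<close>, which selects \<open>R1\<close>, and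
  \<open>one\<close>, which selects \<open>R2\<close>. Closedness makes the rebinding of variable 0
  harmless.\<close>

lemma den_par:
  assumes "fv_rule R1 = {}" "fv_rule R2 = {}"
  shows "den (par R1 R2) A e = den R1 A e \<union> den R2 A e"
proof -
  have "den R1 A (e(0 := a)) = den R1 A e" "den R2 A (e(0 := a)) = den R2 A e" for a
    using assms by (auto intro!: den_cong)
  then show ?thesis by (simp add: par_def Un_commute)
qed

lemma fv_par [simp]: "fv_rule (par R1 R2) = (fv_rule R1 \<union> fv_rule R2) - {0}"
  by (auto simp: par_def)

lemma rule_ok_par [simp]: "rule_ok V (par R1 R2) \<longleftrightarrow> rule_ok V R1 \<and> rule_ok V R2"
  by (simp add: par_def)

primrec switch :: "('r aterm \<times> 'r arule) list \<Rightarrow> 'r arule" where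
  "switch [] = Skip"
| "switch (x # xs) = Cond (fst x) (snd x) (switch xs)"

text \<open>The first true guard wins; as all true guards carry the same rule, its position in the
  list does not matter.\<close>

lemma den_switch:
  assumes "(g, R) \<in> set xs" "val A e g = one"
    and "\<And>g' R'. (g', R') \<in> set xs \<Longrightarrow> val A e g' = one \<Longrightarrow> R' = R"
  shows "den (switch xs) A e = den R A e"
  using assms
proof (induction xs)
  case (Cons x xs)
  show ?case
  proof (cases "val A e (fst x) = one")
    case True
    then have "snd x = R" by (intro Cons.prems(3)[of "fst x"]) simp_all
    then show ?thesis using True by simp
  next
    case False
    then have "(g, R) \<in> set xs" using Cons.prems(1,2) by auto
    then have "den (switch xs) A e = den R A e"
      by (rule Cons.IH[OF _ Cons.prems(2)]) (rule Cons.prems(3), simp_all)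
    then show ?thesis using False by simp
  qed
qed simp

lemma fv_switch: "fv_rule (switch xs) = (\<Union>x \<in> set xs. fv_term (fst x) \<union> fv_rule (snd x))"
  by (induction xs) auto

lemma rule_ok_switch:
  "rule_ok V (switch xs) \<longleftrightarrow>
     (\<forall>x \<in> set xs. term_ok V (fst x) \<and> boolean_term V (fst x) \<and> rule_ok V (snd x))"
  by (induction xs) auto

section \<open>Numerals as terms\<close>

primrec num_term :: "nat \<Rightarrow> 'r aterm" where
  "num_term 0 = App EmptyF []"
| "num_term (Suc n) = App PairF [num_term n, num_term n]"

lemma val_num_term [simp]: "val A e (num_term n) = num n"
  by (induction n) (auto simp: zero_def)

lemma fv_num_term [simp]: "fv_term (num_term n) = {}"
  by (induction n) auto

lemma term_ok_num_term [simp]: "term_ok V (num_term n)"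
  by (induction n) auto

text \<open>\<open>TheUniqueF\<close> maps a non-singleton to the empty set, so this predecessor is
  truncated at 0 exactly as subtraction on \<open>nat\<close> is.\<close>

lemma the_unique_num: "fn_val A TheUniqueF [num n] = num (n - 1)"
  by (cases n) (auto simp: zero_def)

section \<open>Quantification over tuples of atoms, held in blocks of consecutive variables\<close>

definition bind_atoms :: "(nat \<Rightarrow> 'a obj) \<Rightarrow> nat \<Rightarrow> 'a list \<Rightarrow> nat \<Rightarrow> 'a obj" where
  "bind_atoms e b xs = (\<lambda>v. if b \<le> v \<and> v < b + length xs then Atom (xs ! (v - b)) else e v)"

lemma bind_atoms_Nil [simp]: "bind_atoms e b [] = e"
  by (rule ext) (auto simp: bind_atoms_def)

text \<open>The outermost of the nested binders takes the first component; this is the induction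
  step for both \<open>ex_term\<close> and \<open>forall_rule\<close>.\<close>

lemma bind_atoms_Cons: "bind_atoms (e(b := Atom x)) (Suc b) xs = bind_atoms e b (x # xs)"
  by (auto simp: bind_atoms_def fun_eq_iff nth_Cons split: nat.split)
    (metis Suc_diff_le diff_Suc_Suc old.nat.inject)

definition vars :: "nat \<Rightarrow> nat \<Rightarrow> 'r aterm list" where
  "vars b k = map Var [b..<b + k]"

lemma length_vars [simp]: "length (vars b k) = k"
  by (simp add: vars_def)

lemma fv_vars [simp]: "(\<Union>t \<in> set (vars b k). fv_term t) = {b..<b + k}"
  by (auto simp: vars_def)

lemma term_ok_vars [simp]: "\<forall>t \<in> set (vars b k). term_ok V t"
  by (auto simp: vars_def)

lemma val_vars:
  assumes "c + k \<le> length xs"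
  shows "map (val A (bind_atoms e b xs)) (vars (b + c) k) = map Atom (take k (drop c xs))"
  using assms by (intro nth_equalityI) (auto simp: vars_def bind_atoms_def)

lemma val_vars0:
  assumes "length xs = k"
  shows "map (val A (bind_atoms e b xs)) (vars b k) = map Atom xs"
  using val_vars[of 0 k xs A e b] assms by simp

lemma tuples_0 [simp]: "tuples U 0 = {[]}"
  by (auto simp: tuples_def)

lemma tuples_Suc: "tuples U (Suc k) = {x # xs | x xs. x \<in> U \<and> xs \<in> tuples U k}"
  by (auto simp: tuples_def length_Suc_conv)

text \<open>Existence is membership of 0 in a comprehension whose only possible element is 0. The
  equation in the base case turns any \<open>g\<close> into a Boolean term, as the guard of the
  enclosing comprehension must be.\<close>

primrec ex_term :: "nat \<Rightarrow> nat \<Rightarrow> 'r aterm \<Rightarrow> 'r aterm" where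
  "ex_term b 0 g = App EqF [g, App TrueF []]"
| "ex_term b (Suc k) g =
     App InF [App EmptyF [], Compr (App EmptyF []) b (App AtomsF []) (ex_term (Suc b) k g)]"

lemma val_ex_term:
  assumes "finite (universe A)"
  shows "val A e (ex_term b k g) =
    truth (\<exists>xs \<in> tuples (universe A) k. val A (bind_atoms e b xs) g = one)"
proof (induction k arbitrary: b e)
  case (Suc k)
  have "val A e (ex_term b (Suc k) g) =
      truth (\<exists>x \<in> universe A. val A (e(b := Atom x)) (ex_term (Suc b) k g) = one)"
    using assms by (auto simp: fimage.rep_eq ffilter.rep_eq image_iff)
  also have "\<dots> = truth (\<exists>xs \<in> tuples (universe A) (Suc k). val A (bind_atoms e b xs) g = one)"
    by (auto simp: Suc bind_atoms_Cons tuples_Suc simp del: fun_upd_apply)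
  finally show ?case .
qed simp

lemma fv_ex_term: "fv_term (ex_term b k g) = fv_term g - {b..<b + k}"
  by (induction k arbitrary: b) auto

lemma boolean_ex_term [simp]: "boolean_term V (ex_term b k g)"
  by (cases k) auto

lemma term_ok_ex_term [simp]: "term_ok V (ex_term b k g) \<longleftrightarrow> term_ok V g"
  by (induction k arbitrary: b) auto

primrec conj_term :: "'r aterm list \<Rightarrow> 'r aterm" where
  "conj_term [] = App TrueF []"
| "conj_term (t # ts) = App AndF [t, conj_term ts]"

lemma val_conj_term: "val A e (conj_term ts) = truth (\<forall>t \<in> set ts. val A e t = one)"
  by (induction ts) auto

lemma fv_conj_term: "fv_term (conj_term ts) = (\<Union>t \<in> set ts. fv_term t)"
  by (induction ts) auto

lemma term_ok_conj_term: "term_ok V (conj_term ts) \<longleftrightarrow> (\<forall>t \<in> set ts. term_ok V t)"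
  by (induction ts) auto

lemma boolean_conj_term [simp]: "boolean_term V (conj_term ts)"
  by (cases ts) auto

primrec forall_rule :: "nat \<Rightarrow> nat \<Rightarrow> 'r arule \<Rightarrow> 'r arule" where
  "forall_rule b 0 R = R"
| "forall_rule b (Suc k) R = Forall b (App AtomsF []) (forall_rule (Suc b) k R)"

lemma den_forall_rule:
  assumes "finite (universe A)"
  shows "den (forall_rule b k R) A e =
    (\<Union>xs \<in> tuples (universe A) k. den R A (bind_atoms e b xs))"
proof (induction k arbitrary: b e)
  case (Suc k)
  have "den (forall_rule b (Suc k) R) A e =
      (\<Union>x \<in> universe A. den (forall_rule (Suc b) k R) A (e(b := Atom x)))"
    using assms by simp
  also have "\<dots> = (\<Union>xs \<in> tuples (universe A) (Suc k). den R A (bind_atoms e b xs))"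
    by (auto simp: Suc bind_atoms_Cons tuples_Suc simp del: fun_upd_apply)
  finally show ?case .
qed simp

lemma fv_forall_rule: "fv_rule (forall_rule b k R) = fv_rule R - {b..<b + k}"
  by (induction k arbitrary: b) auto

lemma rule_ok_forall_rule [simp]: "rule_ok V (forall_rule b k R) \<longleftrightarrow> rule_ok V R"
  by (induction k arbitrary: b) auto

section \<open>Firing updates\<close>

lemma fire_simps [simp]: "universe (fire D A) = universe A" "rel (fire D A) = rel A"
  by (simp_all add: fire_def)

text \<open>Updates of different functions never clash, so it suffices to compare the function
  names.\<close>

lemma consistent_Un:
  assumes "consistent D" "consistent D'" "fst ` D \<inter> fst ` D' = {}"
  shows "consistent (D \<union> D')"
proof -
  have "(f, xs, b) \<notin> D \<or> (f, ys, c) \<notin> D'" for f xs ys b c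
    using assms(3) by (force simp: disjoint_iff image_iff)
  then show ?thesis using assms(1,2) unfolding consistent_def by blast
qed

lemma dyn_fire_in: "consistent D \<Longrightarrow> (f, xs, b) \<in> D \<Longrightarrow> dyn (fire D A) f xs = b"
  unfolding fire_def consistent_def by auto

lemma dyn_fire_notin: "(\<And>b. (f, xs, b) \<notin> D) \<Longrightarrow> dyn (fire D A) f xs = dyn A f xs"
  by (simp add: fire_def)

lemma universe_sequel [simp]: "universe (sequel R A) = universe A"
  by (simp add: sequel_def Let_def)

lemma universe_state_at [simp]: "universe (state_at R I t) = universe I"
  by (induction t) (simp_all add: state_at_def initial_state_def)

text \<open>Follows the notion of critical object: every value counts, arguments only where the
  value is nonzero. Ranging over all names and argument lists makes the invariant independent of a
  vocabulary.\<close>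

definition dyn_within :: "nat \<Rightarrow> ('r, 'a) asm_state \<Rightarrow> bool" where
  "dyn_within m A \<longleftrightarrow>
     (\<forall>f xs. dyn A f xs \<in> small_objs (universe A) m \<and>
        (dyn A f xs \<noteq> zero \<longrightarrow> set xs \<subseteq> small_objs (universe A) m))"

lemma dyn_within_mono: "dyn_within m A \<Longrightarrow> m \<le> m' \<Longrightarrow> dyn_within m' A"
  using small_objs_mono[of m m' "universe A"] unfolding dyn_within_def by blast

lemma dyn_within_fire:
  assumes "dyn_within m A" "consistent D" "m \<le> m'"
    and D: "\<And>f xs b. (f, xs, b) \<in> D \<Longrightarrow> insert b (set xs) \<subseteq> small_objs (universe A) m'"
  shows "dyn_within m' (fire D A)"
  unfolding dyn_within_def
proof (intro allI)
  fix f xs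
  have A: "dyn_within m' A" using assms dyn_within_mono by blast
  show "dyn (fire D A) f xs \<in> small_objs (universe (fire D A)) m' \<and>
        (dyn (fire D A) f xs \<noteq> zero \<longrightarrow> set xs \<subseteq> small_objs (universe (fire D A)) m')"
  proof (cases "\<exists>b. (f, xs, b) \<in> D")
    case True
    then obtain b where b: "(f, xs, b) \<in> D" by blast
    then show ?thesis using D[OF b] dyn_fire_in[OF assms(2) b, of A] by simp
  next
    case False
    then show ?thesis using A dyn_fire_notin[of f xs D A] by (auto simp: dyn_within_def)
  qed
qed

text \<open>Transitivity of \<open>small_objs\<close> absorbs the closure under \<open>TC\<close>.
  The bound must reach 1 because \<open>one\<close> is critical at every state.\<close>

lemma active_small_objs:
  assumes "dyn_within m A" "1 \<le> m"
  shows "active V A \<subseteq> small_objs (universe A) m"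
proof -
  have "one \<in> small_objs (universe A) m"
    using truth_in_small_objs[OF assms(2), of True] by (simp add: truth_def)
  then have "critical V A \<subseteq> small_objs (universe A) m"
    using assms(1) unfolding critical_def dyn_within_def by auto
  then show ?thesis
    using TC_small_objs unfolding active_def by blast
qed

section \<open>Simulation of a relational machine\<close>

abbreviation "ctrl_name \<equiv> Dyn 0"
abbreviation "pos_name \<equiv> Dyn (Suc 0)"
abbreviation "neg_name \<equiv> Dyn 2"
abbreviation "tape_name \<equiv> Dyn 3"

abbreviation dyn_const :: "dyn_name \<Rightarrow> 'r aterm" where
  "dyn_const f \<equiv> App (DynF f) []"

text \<open>One step in the direction counted by \<open>f\<close>: cancel a step counted by
  \<open>g\<close> if there is one, otherwise count one more in \<open>f\<close>. The assignment to
  \<open>g\<close> can be unconditional since the truncated predecessor fixes 0.\<close>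

definition shift_rule :: "dyn_name \<Rightarrow> dyn_name \<Rightarrow> 'r arule" where
  "shift_rule f g =
     par (Assign g [] (App TheUniqueF [dyn_const g]))
       (Cond (App EqF [dyn_const g, num_term 0])
          (Assign f [] (App PairF [dyn_const f, dyn_const f])) Skip)"

lemma den_shift_rule:
  assumes "dyn A f [] = num m" "dyn A g [] = num n"
  shows "den (shift_rule f g) A e =
    {(g, [], num (n - 1))} \<union> (if n = 0 then {(f, [], num (Suc m))} else {})"
  using assms unfolding shift_rule_def
  by (subst den_par) (auto simp: the_unique_num simp del: fn_val.simps(11) num_term.simps)

fun move_rule :: "move \<Rightarrow> 'r arule" where
  "move_rule Stay = Skip"
| "move_rule MoveRight = shift_rule pos_name neg_name"
| "move_rule MoveLeft = shift_rule neg_name pos_name"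

text \<open>Relation names have an arbitrary type but dynamic functions are named by natural
  numbers, hence the injection \<open>idx\<close>. The list \<open>instrs\<close> puts the finite
  set of instructions into an order in which a program can test them.\<close>

locale machine_simulation =
  fixes \<Upsilon>0 :: "'r vocab" and M :: "'r rel_machine"
    and idx :: "'r \<Rightarrow> nat" and instrs :: "'r instr list"
  assumes machine: "relational_machine \<Upsilon>0 M"
    and inj_idx: "inj_on idx (dom (rm_vocab M))"
    and set_instrs: "set instrs = rm_instrs M"
begin

text \<open>
  The initial control state and the blank are coded by 0, and the relation \<open>r\<close> of the store is
  the symmetric difference of the input relation \<open>r\<close> and of \<open>rel_name r\<close>. Thus the initial
  state, in which all dynamic functions are 0, represents the initial configuration and no
  initialization is needed.
\<close>

definition ctrl_code :: "nat \<Rightarrow> nat" where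
  "ctrl_code q = (if q = rm_init M then 0 else Suc q)"

definition sym_code :: "nat \<Rightarrow> nat" where
  "sym_code s = (if s = rm_blank M then 0 else Suc s)"

definition rel_name :: "'r \<Rightarrow> dyn_name" where
  "rel_name r = Dyn (4 + idx r)"

definition arity :: "'r \<Rightarrow> nat" where
  "arity r = the (rm_vocab M r)"

definition asm_dyn_arity :: "dyn_name \<Rightarrow> nat option" where
  "asm_dyn_arity f =
     (case f of
        Dyn m \<Rightarrow>
          if m < 3 then Some 0
          else if m = 3 then Some 2
          else if m - 4 \<in> idx ` dom (rm_vocab M)
               then rm_vocab M (inv_into (dom (rm_vocab M)) idx (m - 4))
          else None
      | _ \<Rightarrow> Some 0)"

text \<open>The functions for the store are not declared as predicates: the invariant keeps their
  values Boolean on tuples of atoms, and \<open>rel_term\<close> wraps them into Boolean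
  terms.\<close>

definition asm_voc :: "'r asm_vocab" where
  "asm_voc =
     \<lparr>input_arity = \<Upsilon>0, dyn_arity = asm_dyn_arity, dyn_preds = {Halt, Output}\<rparr>"

text \<open>Outside \<Upsilon>0 the name \<open>InputF r\<close> has no arity and \<open>rel\<close>
  may be junk. The constant false fits there, since such a relation starts empty.\<close>

definition input_term :: "'r \<Rightarrow> 'r aterm list \<Rightarrow> 'r aterm" where
  "input_term r ts = (if r \<in> dom \<Upsilon>0 then App (InputF r) ts else App FalseF [])"

text \<open>Inequality of Booleans is exclusive or, that is, membership in the symmetric
  difference.\<close>

definition rel_term :: "'r \<Rightarrow> 'r aterm list \<Rightarrow> 'r aterm" where
  "rel_term r ts = App NotF [App EqF [App (DynF (rel_name r)) ts, input_term r ts]]"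

text \<open>The variables below \<open>n\<close> hold a candidate tuple of the result. For a
  projection the preimage is quantified over variables from \<open>n\<close> on, so that no variable
  of the candidate is captured.\<close>

fun op_term :: "nat \<Rightarrow> 'r relop \<Rightarrow> 'r aterm" where
  "op_term n (UnionOp i j) = App OrF [rel_term i (vars 0 n), rel_term j (vars 0 n)]"
| "op_term n (InterOp i j) = App AndF [rel_term i (vars 0 n), rel_term j (vars 0 n)]"
| "op_term n (DiffOp i j) = App AndF [rel_term i (vars 0 n), App NotF [rel_term j (vars 0 n)]]"
| "op_term n (ComplOp i) = App NotF [rel_term i (vars 0 n)]"
| "op_term n (ProjOp cs i) =
     ex_term n (arity i)
       (conj_term (rel_term i (vars n (arity i)) #
          map (\<lambda>j. App EqF [Var j, Var (n + cs ! j)]) [0..<n]))"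
| "op_term n (ProdOp i j) =
     App AndF [rel_term i (vars 0 (arity i)), rel_term j (vars (arity i) (arity j))]"
| "op_term n (SelectOp c d i) = App AndF [rel_term i (vars 0 n), App EqF [Var c, Var d]]"

text \<open>The result is combined with the input relation before it is stored;
  \<open>rel_term\<close> does so again when reading, and the two differences cancel.\<close>

definition assign_rule :: "'r \<Rightarrow> 'r relop \<Rightarrow> 'r arule" where
  "assign_rule k e =
     forall_rule 0 (arity k)
       (Assign (rel_name k) (vars 0 (arity k))
          (App NotF [App EqF [op_term (arity k) e, input_term k (vars 0 (arity k))]]))"

definition store_rule :: "('r \<times> 'r relop) option \<Rightarrow> 'r arule" where
  "store_rule a = (case a of None \<Rightarrow> Skip | Some (k, e) \<Rightarrow> assign_rule k e)"

definition ctrl_guard :: "nat \<Rightarrow> 'r aterm" where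
  "ctrl_guard q = App EqF [dyn_const ctrl_name, num_term (ctrl_code q)]"

definition scanned_term :: "'r aterm" where
  "scanned_term = App (DynF tape_name) [dyn_const pos_name, dyn_const neg_name]"

definition test_term :: "('r \<times> bool) option \<Rightarrow> 'r aterm" where
  "test_term a =
     (case a of
        None \<Rightarrow> App TrueF []
      | Some (r, b) \<Rightarrow>
          App EqF [ex_term 0 (arity r) (rel_term r (vars 0 (arity r))),
            if b then App FalseF [] else App TrueF []])"

definition guard :: "'r instr \<Rightarrow> 'r aterm" where
  "guard i =
     conj_term [ctrl_guard (in_ctrl i),
       App EqF [scanned_term, num_term (sym_code (in_sym i))], test_term (in_test i)]"

text \<open>All four parts read the old state: the symbol goes to the cell scanned before the move,
  and the operation uses the old relations, as in \<open>rm_fire\<close>.\<close>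

definition instr_rule :: "'r instr \<Rightarrow> 'r arule" where
  "instr_rule i =
     par (par (Assign ctrl_name [] (num_term (ctrl_code (out_ctrl i))))
            (Assign tape_name [dyn_const pos_name, dyn_const neg_name]
               (num_term (sym_code (out_sym i)))))
       (par (move_rule (out_move i)) (store_rule (out_op i)))"

definition acc_rule :: "'r arule" where
  "acc_rule = par (Assign Halt [] (App TrueF [])) (Assign Output [] (App TrueF []))"

text \<open>\<open>Output\<close> is initially false and no \<open>instr_rule\<close> touches it, so
  a rejection only has to halt.\<close>

definition rej_rule :: "'r arule" where
  "rej_rule = Assign Halt [] (App TrueF [])"

text \<open>\<open>rm_step\<close> fires nothing in an accepting or rejecting control state.
  Filtering out the instructions for these states keeps their guards from competing with the halting
  rules.\<close>

definition prog_cases :: "('r aterm \<times> 'r arule) list" where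
  "prog_cases =
     map (\<lambda>q. (ctrl_guard q, acc_rule)) (sorted_list_of_set (rm_acc M)) @
     map (\<lambda>q. (ctrl_guard q, rej_rule)) (sorted_list_of_set (rm_rej M)) @
     map (\<lambda>i. (guard i, instr_rule i))
       (filter (\<lambda>i. in_ctrl i \<notin> rm_acc M \<union> rm_rej M) instrs)"

definition prog :: "'r arule" where
  "prog = switch prog_cases"

lemma finite_acc: "finite (rm_acc M)" and finite_rej: "finite (rm_rej M)"
  and acc_rej_disjoint: "rm_acc M \<inter> rm_rej M = {}"
  and input_vocab: "\<Upsilon>0 \<subseteq>\<^sub>m rm_vocab M"
  and instr_ok: "i \<in> rm_instrs M \<Longrightarrow> instr_ok (rm_vocab M) i"
  and finite_instrs: "finite (rm_instrs M)"
  and finite_vocab: "finite (dom (rm_vocab M))"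
  and deterministic: "deterministic (rm_instrs M)"
  using machine unfolding relational_machine_def by auto

lemma set_prog_cases:
  "set prog_cases =
     (\<lambda>q. (ctrl_guard q, acc_rule)) ` rm_acc M \<union>
     (\<lambda>q. (ctrl_guard q, rej_rule)) ` rm_rej M \<union>
     (\<lambda>i. (guard i, instr_rule i)) ` {i \<in> rm_instrs M. in_ctrl i \<notin> rm_acc M \<union> rm_rej M}"
  unfolding prog_cases_def by (auto simp: finite_acc finite_rej set_instrs)

text \<open>The shift by \<open>Suc\<close> reserves the code 0 for the initial control state;
  likewise for the blank below.\<close>

lemma ctrl_code_eq [simp]: "ctrl_code q = ctrl_code q' \<longleftrightarrow> q = q'"
  by (auto simp: ctrl_code_def)

lemma sym_code_eq [simp]: "sym_code s = sym_code s' \<longleftrightarrow> s = s'"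
  by (auto simp: sym_code_def)

lemma rel_name_eq:
  "r \<in> dom (rm_vocab M) \<Longrightarrow> r' \<in> dom (rm_vocab M) \<Longrightarrow> rel_name r = rel_name r' \<longleftrightarrow> r = r'"
  using inj_idx by (auto simp: rel_name_def inj_on_eq_iff)

lemma rel_name_neq [simp]:
  "rel_name r \<noteq> ctrl_name" "rel_name r \<noteq> pos_name" "rel_name r \<noteq> neg_name"
  "rel_name r \<noteq> tape_name" "rel_name r \<noteq> Halt" "rel_name r \<noteq> Output"
  "ctrl_name \<noteq> rel_name r" "pos_name \<noteq> rel_name r" "neg_name \<noteq> rel_name r"
  "tape_name \<noteq> rel_name r" "Halt \<noteq> rel_name r" "Output \<noteq> rel_name r"
  by (auto simp: rel_name_def)

subsection \<open>Well-formedness\<close>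

lemma dyn_arity_voc [simp]: "dyn_arity asm_voc = asm_dyn_arity"
  and input_arity_voc [simp]: "input_arity asm_voc = \<Upsilon>0"
  and dyn_preds_voc [simp]: "dyn_preds asm_voc = {Halt, Output}"
  by (simp_all add: asm_voc_def)

lemma asm_dyn_arity_simps [simp]:
  "asm_dyn_arity Halt = Some 0" "asm_dyn_arity Output = Some 0"
  "asm_dyn_arity ctrl_name = Some 0" "asm_dyn_arity pos_name = Some 0"
  "asm_dyn_arity neg_name = Some 0" "asm_dyn_arity tape_name = Some 2"
  by (simp_all add: asm_dyn_arity_def)

lemma asm_dyn_arity_rel [simp]:
  assumes "rm_vocab M r = Some k"
  shows "asm_dyn_arity (rel_name r) = Some k"
proof -
  have "r \<in> dom (rm_vocab M)" using assms by auto
  then show ?thesis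
    using assms inj_idx by (simp add: asm_dyn_arity_def rel_name_def)
qed

lemma arity_eq [simp]: "rm_vocab M r = Some k \<Longrightarrow> arity r = k"
  by (simp add: arity_def)

lemma vocab_ok_voc: "vocab_ok asm_voc"
proof -
  have "dom asm_dyn_arity \<subseteq>
      {Halt, Output} \<union> Dyn ` {..3} \<union> (\<lambda>m. Dyn (4 + m)) ` idx ` dom (rm_vocab M)"
  proof
    fix f assume f: "f \<in> dom asm_dyn_arity"
    show "f \<in> {Halt, Output} \<union> Dyn ` {..3} \<union> (\<lambda>m. Dyn (4 + m)) ` idx ` dom (rm_vocab M)"
    proof (cases f)
      case (Dyn m)
      show ?thesis
      proof (cases "m \<le> 3")
        case False
        then have "m - 4 \<in> idx ` dom (rm_vocab M)" "m = 4 + (m - 4)"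
          using f Dyn by (auto simp: asm_dyn_arity_def split: if_splits)
        then show ?thesis using Dyn by blast
      qed (use Dyn in auto)
    qed auto
  qed
  then have "finite (dom asm_dyn_arity)"
    by (rule finite_subset) (simp add: finite_vocab)
  moreover have "finite (dom \<Upsilon>0)"
    using map_le_implies_dom_le[OF input_vocab] finite_vocab finite_subset by blast
  ultimately show ?thesis
    unfolding vocab_ok_def by auto
qed

lemma term_ok_input_term:
  assumes "rm_vocab M r = Some (length ts)" "\<forall>t \<in> set ts. term_ok asm_voc t"
  shows "term_ok asm_voc (input_term r ts)"
  using assms input_vocab by (auto simp: input_term_def map_le_def dest!: bspec)

lemma term_ok_rel_term:
  assumes "rm_vocab M r = Some (length ts)" "\<forall>t \<in> set ts. term_ok asm_voc t"
  shows "term_ok asm_voc (rel_term r ts)"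
  using assms term_ok_input_term[OF assms] by (simp add: rel_term_def)

lemma fv_input_term: "fv_term (input_term r ts) \<subseteq> (\<Union>t \<in> set ts. fv_term t)"
  by (simp add: input_term_def)

lemma fv_rel_term [simp]: "fv_term (rel_term r ts) = (\<Union>t \<in> set ts. fv_term t)"
  using fv_input_term[of r ts] by (auto simp: rel_term_def)

lemma term_ok_op_term:
  assumes "op_ok (rm_vocab M) k e"
  shows "term_ok asm_voc (op_term (arity k) e)"
  using assms
  by (cases e) (auto intro!: term_ok_rel_term simp: term_ok_conj_term)

lemma fv_op_term:
  assumes "op_ok (rm_vocab M) k e"
  shows "fv_term (op_term (arity k) e) \<subseteq> {0..<arity k}"
  using assms
  by (cases e) (auto simp: fv_ex_term fv_conj_term)

lemma assign_rule_ok: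
  assumes "op_ok (rm_vocab M) k e"
  shows "rule_ok asm_voc (assign_rule k e)" "fv_rule (assign_rule k e) = {}"
proof -
  obtain n where n: "rm_vocab M k = Some n"
    using assms by (cases e) auto
  show "rule_ok asm_voc (assign_rule k e)"
    using term_ok_op_term[OF assms] n
    by (auto simp: assign_rule_def term_ok_input_term)
  show "fv_rule (assign_rule k e) = {}"
    using fv_op_term[OF assms] fv_input_term[of k "vars 0 (arity k)"]
    by (auto simp: assign_rule_def fv_forall_rule)
qed

lemma store_rule_ok:
  assumes "i \<in> rm_instrs M"
  shows "rule_ok asm_voc (store_rule (out_op i))" "fv_rule (store_rule (out_op i)) = {}"
  using instr_ok[OF assms] assign_rule_ok
  by (auto simp: store_rule_def instr_ok_def split: option.split)

lemma move_rule_ok: "rule_ok asm_voc (move_rule m)" "fv_rule (move_rule m :: 'r arule) = {}"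
  by (cases m; simp add: shift_rule_def)+

lemma instr_rule_ok:
  assumes "i \<in> rm_instrs M"
  shows "rule_ok asm_voc (instr_rule i)" "fv_rule (instr_rule i) = {}"
  using store_rule_ok[OF assms] move_rule_ok by (simp_all add: instr_rule_def)

lemma guard_ok:
  assumes "i \<in> rm_instrs M"
  shows "term_ok asm_voc (guard i)" "fv_term (guard i) = {}" "boolean_term asm_voc (guard i)"
  using instr_ok[OF assms]
  by (auto simp: guard_def ctrl_guard_def scanned_term_def test_term_def instr_ok_def
      term_ok_rel_term fv_ex_term split: option.split)

lemma program_prog: "program asm_voc prog"
  unfolding program_def prog_def rule_ok_switch fv_switch set_prog_cases
  by (auto simp: guard_ok instr_rule_ok ctrl_guard_def acc_rule_def rej_rule_def)

subsection \<open>Representation of configurations\<close>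

text \<open>The functions are described only on tuples of atoms of the right length; the inclusion
  ensures that these determine the whole relation. It is part of the invariant, as quantified terms
  see no other tuples.\<close>

definition store_rep :: "('r, 'a) asm_state \<Rightarrow> ('r, 'a) struct \<Rightarrow> bool" where
  "store_rep A B \<longleftrightarrow> finite (universe A) \<and> universe B = universe A \<and>
     (\<forall>r k. rm_vocab M r = Some k \<longrightarrow>
        rel B r \<subseteq> tuples (universe A) k \<and>
        (\<forall>xs \<in> tuples (universe A) k. dyn A (rel_name r) (map Atom xs) =
           truth ((xs \<in> rel B r) \<noteq> (r \<in> dom \<Upsilon>0 \<and> xs \<in> rel A r))))"

section \<open>Evaluation of terms over the relational store\<close>

lemma val_input_term:
  assumes "map (val A e) ts = map Atom xs"
  shows "val A e (input_term r ts) = truth (r \<in> dom \<Upsilon>0 \<and> xs \<in> rel A r)"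
proof -
  have "map Atom xs = map Atom ys \<longleftrightarrow> xs = ys" for ys
    by (simp add: inj_map_eq_map inj_def)
  then show ?thesis
    using assms by (auto simp: input_term_def truth_def)
qed

lemma val_rel_term:
  assumes "store_rep A B" "rm_vocab M r = Some k" "xs \<in> tuples (universe A) k"
    and "map (val A e) ts = map Atom xs"
  shows "val A e (rel_term r ts) = truth (xs \<in> rel B r)"
  using assms val_input_term[OF assms(4), of r]
  by (auto simp: rel_term_def store_rep_def)

text \<open>Reads a relation on a block of a longer tuple, as each factor of a Cartesian product
  requires.\<close>

lemma val_rel_term_vars:
  assumes "store_rep A B" "rm_vocab M r = Some k" "xs \<in> tuples (universe A) n" "c + k \<le> n"
  shows "val A (bind_atoms e b xs) (rel_term r (vars (b + c) k)) =
    truth (take k (drop c xs) \<in> rel B r)"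
proof (rule val_rel_term[OF assms(1,2)])
  show "take k (drop c xs) \<in> tuples (universe A) k"
    using assms(3,4) by (auto simp: tuples_def dest!: in_set_takeD in_set_dropD)
  show "map (val A (bind_atoms e b xs)) (vars (b + c) k) = map Atom (take k (drop c xs))"
    using assms(3,4) by (intro val_vars) (simp add: tuples_def)
qed

lemma val_rel_term_vars0:
  assumes "store_rep A B" "rm_vocab M r = Some k" "xs \<in> tuples (universe A) k"
  shows "val A (bind_atoms e b xs) (rel_term r (vars b k)) = truth (xs \<in> rel B r)"
  using val_rel_term_vars[OF assms, of 0 e b] assms(3) by (simp add: tuples_def)

text \<open>Preserves the inclusion demanded by \<open>store_rep\<close> when a relation is
  overwritten.\<close>

lemma op_val_tuples:
  assumes "store_rep A B" "op_ok (rm_vocab M) k e" "rm_vocab M k = Some n"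
  shows "op_val (rm_vocab M) B e \<subseteq> tuples (universe A) n"
proof (cases e)
  case (ProjOp cs i)
  then obtain a where a: "rm_vocab M i = Some a" "\<forall>c \<in> set cs. c < a" "n = length cs"
    using assms by auto
  then have "rel B i \<subseteq> tuples (universe A) a" using assms(1) by (auto simp: store_rep_def)
  then show ?thesis using ProjOp a by (fastforce simp: tuples_def)
next
  case (ProdOp i j)
  then obtain a b where a: "rm_vocab M i = Some a" "rm_vocab M j = Some b" "n = a + b"
    using assms by auto
  then have "rel B i \<subseteq> tuples (universe A) a" "rel B j \<subseteq> tuples (universe A) b"
    using assms(1) by (auto simp: store_rep_def)
  then show ?thesis using ProdOp a by (fastforce simp: tuples_def)
qed (use assms in \<open>fastforce simp: store_rep_def\<close>)+

lemma val_op_term: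
  assumes "store_rep A B" "op_ok (rm_vocab M) k e" "rm_vocab M k = Some n"
    and xs: "xs \<in> tuples (universe A) n"
  shows "val A (bind_atoms v 0 xs) (op_term n e) = truth (xs \<in> op_val (rm_vocab M) B e)"
proof (cases e)
  case (ProjOp cs i)
  then obtain a where a: "rm_vocab M i = Some a" "\<forall>c \<in> set cs. c < a" "n = length cs"
    using assms by auto
  have len: "length xs = n" using xs by (simp add: tuples_def)
  \<comment> \<open>The candidate \<open>xs\<close> occupies the variables below \<open>n\<close>,
    the preimage \<open>ys\<close> the next \<open>a\<close> variables.\<close>
  have "val A (bind_atoms (bind_atoms v 0 xs) n ys)
      (conj_term (rel_term i (vars n a) #
         map (\<lambda>j. App EqF [Var j, Var (n + cs ! j)]) [0..<n])) =
      truth (ys \<in> rel B i \<and> xs = map (\<lambda>c. ys ! c) cs)"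
    if ys: "ys \<in> tuples (universe A) a" for ys
  proof -
    have "length ys = a" using ys by (simp add: tuples_def)
    then have "bind_atoms (bind_atoms v 0 xs) n ys (n + cs ! j) = Atom (ys ! (cs ! j))"
      "bind_atoms (bind_atoms v 0 xs) n ys j = Atom (xs ! j)" if "j < n" for j
      using that a len by (auto simp: bind_atoms_def)
    moreover have "xs = map (\<lambda>c. ys ! c) cs \<longleftrightarrow> (\<forall>j < n. xs ! j = ys ! (cs ! j))"
      using len a(3) by (auto intro: nth_equalityI)
    ultimately show ?thesis
      by (auto simp: val_conj_term val_rel_term_vars0[OF assms(1) a(1) ys])
  qed
  moreover have "rel B i \<subseteq> tuples (universe A) a" "finite (universe A)"
    using assms(1) a(1) by (auto simp: store_rep_def)
  ultimately show ?thesis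
    using ProjOp a by (auto simp: val_ex_term simp del: conj_term.simps)
next
  case (ProdOp i j)
  then obtain a b where a: "rm_vocab M i = Some a" "rm_vocab M j = Some b" "n = a + b"
    using assms by auto
  have len: "length xs = n" using xs by (simp add: tuples_def)
  have sub: "rel B i \<subseteq> tuples (universe A) a"
    using assms(1) a by (auto simp: store_rep_def)
  have "xs \<in> op_val (rm_vocab M) B e \<longleftrightarrow> take a xs \<in> rel B i \<and> drop a xs \<in> rel B j"
  proof
    assume "xs \<in> op_val (rm_vocab M) B e"
    then obtain ys zs where "xs = ys @ zs" "ys \<in> rel B i" "zs \<in> rel B j"
      using ProdOp by auto
    \<comment> \<open>All members of the first factor have length \<open>a\<close>, so the tuple can
      be split in only one place.\<close>
    moreover have "length ys = a" using sub calculation by (auto simp: tuples_def)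
    ultimately show "take a xs \<in> rel B i \<and> drop a xs \<in> rel B j" by simp
  next
    assume "take a xs \<in> rel B i \<and> drop a xs \<in> rel B j"
    then show "xs \<in> op_val (rm_vocab M) B e"
      using ProdOp append_take_drop_id[of a xs] by (simp, metis)
  qed
  then show ?thesis
    using ProdOp a len val_rel_term_vars[OF assms(1) a(1) xs, of 0 v 0]
      val_rel_term_vars[OF assms(1) a(2) xs, of a v 0]
    by simp
next
  case (SelectOp c d i)
  then show ?thesis
    using assms val_rel_term_vars0[OF assms(1) _ xs, of i v 0]
    by (auto simp: bind_atoms_def tuples_def)
qed (use assms val_rel_term_vars0[OF assms(1) _ xs, of _ v 0] in \<open>auto simp: store_rep_def\<close>)

lemma den_assign_rule:
  assumes "store_rep A B" "op_ok (rm_vocab M) k e" "rm_vocab M k = Some n"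
  shows "den (assign_rule k e) A v =
    (\<lambda>xs. (rel_name k, map Atom xs,
       truth ((xs \<in> op_val (rm_vocab M) B e) \<noteq> (k \<in> dom \<Upsilon>0 \<and> xs \<in> rel A k)))) `
    tuples (universe A) n"
proof -
  have "finite (universe A)" using assms(1) by (simp add: store_rep_def)
  moreover have "val A (bind_atoms v 0 xs) (input_term k (vars 0 n)) =
      truth (k \<in> dom \<Upsilon>0 \<and> xs \<in> rel A k)"
    "map (val A (bind_atoms v 0 xs)) (vars 0 n) = map Atom xs"
    if "xs \<in> tuples (universe A) n" for xs
    using that by (auto intro!: val_input_term val_vars0 simp: tuples_def)
  ultimately show ?thesis
    using assms(3) val_op_term[OF assms]
    by (auto simp: assign_rule_def den_forall_rule)
qed

lemma val_test_term:
  assumes "store_rep A B" "case a of None \<Rightarrow> True | Some (r, b) \<Rightarrow> r \<in> dom (rm_vocab M)"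
  shows "val A v (test_term a) =
    truth (case a of None \<Rightarrow> True | Some (r, b) \<Rightarrow> (rel B r = {}) = b)"
proof (cases a)
  case (Some p)
  obtain r b where p: "p = (r, b)" by (cases p)
  then obtain k where k: "rm_vocab M r = Some k" using assms(2) Some by auto
  have fin: "finite (universe A)" and sub: "rel B r \<subseteq> tuples (universe A) k"
    using assms(1) k by (auto simp: store_rep_def)
  have "val A v (ex_term 0 k (rel_term r (vars 0 k))) = truth (rel B r \<noteq> {})"
    using sub val_rel_term_vars0[OF assms(1) k, of _ v 0] by (auto simp: val_ex_term[OF fin])
  then show ?thesis using Some p k by (auto simp: test_term_def)
qed (simp add: test_term_def truth_def)

text \<open>Independent of the input. The sum dominates each code the program writes, the initial
  codes are 0, and the summand 1 leaves room for \<open>one\<close>.\<close>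

definition code_bound :: nat where
  "code_bound = 1 + (\<Sum>i \<in> rm_instrs M. ctrl_code (out_ctrl i) + sym_code (out_sym i))"

lemma code_bound:
  assumes "i \<in> rm_instrs M"
  shows "ctrl_code (out_ctrl i) \<le> code_bound" "sym_code (out_sym i) \<le> code_bound"
  using member_le_sum[OF assms _ finite_instrs,
      of "\<lambda>i. ctrl_code (out_ctrl i) + sym_code (out_sym i)"]
  by (auto simp: code_bound_def)

text \<open>The tape function matters only at pairs of the form \<open>(nat z, nat (- z))\<close>.
  The conditions on \<open>Halt\<close> keep the run alive, and the last two conjuncts carry the
  space bound: the head counters are the only numerals that grow with \<open>t\<close>.\<close>

definition represents :: "nat \<Rightarrow> ('r, 'a) asm_state \<Rightarrow> ('r, 'a) rm_config \<Rightarrow> bool" where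
  "represents t A c \<longleftrightarrow>
     store_rep A (store c) \<and>
     dyn A ctrl_name [] = num (ctrl_code (ctrl c)) \<and>
     dyn A pos_name [] = num (nat (head c)) \<and>
     dyn A neg_name [] = num (nat (- head c)) \<and>
     (\<forall>z. dyn A tape_name [num (nat z), num (nat (- z))] = num (sym_code (tape c z))) \<and>
     \<not> holds A Halt \<and> \<not> holds A Output \<and>
     \<bar>head c\<bar> \<le> int t \<and> dyn_within (code_bound + t) A"

text \<open>Everything is 0: the codes of initial state and blank, both counters, and the difference
  between the initial store and the input.\<close>

lemma represents_initial:
  assumes "finite_structure \<Upsilon>0 I"
  shows "represents 0 (initial_state I) (rm_start \<Upsilon>0 M I)"
proof -
  have "rel I r \<subseteq> tuples (universe I) k" if "rm_vocab M r = Some k" "r \<in> dom \<Upsilon>0" for r k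
    using that assms input_vocab by (auto simp: finite_structure_def map_le_def)
  then have "store_rep (initial_state I) (store (rm_start \<Upsilon>0 M I))"
    using assms
    by (auto simp: store_rep_def initial_state_def rm_start_def finite_structure_def)
  then show ?thesis
    by (simp add: represents_def initial_state_def rm_start_def holds_def ctrl_code_def
        sym_code_def dyn_within_def)
qed

section \<open>Guards and update sets in a represented state\<close>

lemma val_ctrl_guard:
  assumes "represents t A c"
  shows "val A v (ctrl_guard q) = truth (ctrl c = q)"
  using assms by (simp add: represents_def ctrl_guard_def)

lemma val_guard:
  assumes "represents t A c" "i \<in> rm_instrs M"
  shows "val A v (guard i) =
    truth (enabled i (ctrl c) (tape c (head c)) (\<lambda>r. rel (store c) r = {}))"
proof -
  have "store_rep A (store c)" using assms by (simp add: represents_def)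
  from val_test_term[OF this, of "in_test i" v]
  have "val A v (test_term (in_test i)) = one \<longleftrightarrow>
      (case in_test i of None \<Rightarrow> True | Some (r, b) \<Rightarrow> (rel (store c) r = {}) = b)"
    using instr_ok[OF assms(2)] by (simp add: instr_ok_def)
  moreover have "val A v (App EqF [scanned_term, num_term (sym_code (in_sym i))]) =
      truth (in_sym i = tape c (head c))"
    using assms(1) by (auto simp: scanned_term_def represents_def)
  ultimately show ?thesis
    using val_ctrl_guard[OF assms(1), of v "in_ctrl i"]
    by (auto simp: guard_def val_conj_term enabled_def simp del: val.simps conj_term.simps)
qed

lemma den_instr_rule:
  assumes "represents t A c" "i \<in> rm_instrs M"
  shows "den (instr_rule i) A v =
    {(ctrl_name, [], num (ctrl_code (out_ctrl i))),
     (tape_name, [num (nat (head c)), num (nat (- head c))], num (sym_code (out_sym i)))} \<union>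
    (den (move_rule (out_move i)) A v \<union> den (store_rule (out_op i)) A v)"
  using assms(1) move_rule_ok store_rule_ok[OF assms(2)]
  by (simp add: instr_rule_def den_par represents_def insert_commute)

lemma den_move_rule:
  assumes "represents t A c"
  defines "h \<equiv> head c"
  shows "den (move_rule m) A v =
    (case m of
       Stay \<Rightarrow> {}
     | MoveRight \<Rightarrow> {(neg_name, [], num (nat (- h) - 1))} \<union>
         (if h \<ge> 0 then {(pos_name, [], num (Suc (nat h)))} else {})
     | MoveLeft \<Rightarrow> {(pos_name, [], num (nat h - 1))} \<union>
         (if h \<le> 0 then {(neg_name, [], num (Suc (nat (- h))))} else {}))"
proof -
  have "dyn A pos_name [] = num (nat h)" "dyn A neg_name [] = num (nat (- h))"
    using assms by (simp_all add: represents_def)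
  note den_shift_rule[OF this(1,2), of v] den_shift_rule[OF this(2,1), of v]
  then show ?thesis by (auto split: move.split)
qed

lemma den_store_rule:
  assumes "represents t A c" "i \<in> rm_instrs M"
  shows "den (store_rule (out_op i)) A v =
    (case out_op i of
       None \<Rightarrow> {}
     | Some (k, e) \<Rightarrow>
         (\<lambda>xs. (rel_name k, map Atom xs,
            truth ((xs \<in> op_val (rm_vocab M) (store c) e) \<noteq>
              (k \<in> dom \<Upsilon>0 \<and> xs \<in> rel A k)))) ` tuples (universe A) (arity k))"
proof (cases "out_op i")
  case (Some p)
  obtain k e where p: "p = (k, e)" by (cases p)
  then have ok: "op_ok (rm_vocab M) k e"
    using instr_ok[OF assms(2)] Some by (simp add: instr_ok_def)
  then obtain n where "rm_vocab M k = Some n" by (cases e) auto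
  then show ?thesis
    using den_assign_rule[OF _ ok, of A "store c" n v] assms(1) Some p
    by (simp add: store_rule_def represents_def)
qed (simp add: store_rule_def)

text \<open>Control, tape, head counters and store have pairwise different function names, so their
  updates cannot clash and each component of the configuration can be checked on its own.\<close>

lemma represents_fire:
  fixes A :: "('r, 'a) asm_state" and v :: "nat \<Rightarrow> 'a obj"
  assumes rep: "represents t A c" and i: "i \<in> rm_instrs M"
  defines "D \<equiv> den (instr_rule i) A v"
  shows "consistent D" "represents (Suc t) (fire D A) (rm_fire (rm_vocab M) i c)"
proof -
  define h where "h = head c"
  define Dm where "Dm = den (move_rule (out_move i)) A v"
  define Ds where "Ds = den (store_rule (out_op i)) A v"
  note D = den_instr_rule[OF rep i, of v, folded D_def Dm_def Ds_def h_def]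
  note Dm = den_move_rule[OF rep, of "out_move i" v, folded Dm_def h_def]
  note Ds = den_store_rule[OF rep i, of v, folded Ds_def]
  have store: "store_rep A (store c)" and hd: "\<bar>h\<bar> \<le> int t"
    and within: "dyn_within (code_bound + t) A"
    and pos: "dyn A pos_name [] = num (nat h)" and neg: "dyn A neg_name [] = num (nat (- h))"
    and tp: "\<And>z. dyn A tape_name [num (nat z), num (nat (- z))] = num (sym_code (tape c z))"
    and halt: "\<not> holds A Halt" "\<not> holds A Output"
    using rep by (auto simp: represents_def h_def)
  have Dm_names: "f \<in> {pos_name, neg_name} \<and> xs = []" if "(f, xs, b) \<in> Dm" for f xs b
    using that unfolding Dm by (auto split: move.splits if_splits)
  have Ds_names: "\<exists>r. f = rel_name r" if "(f, xs, b) \<in> Ds" for f xs b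
    using that unfolding Ds by (auto split: option.splits)
  have fst_Dm: "fst ` Dm \<subseteq> {pos_name, neg_name}"
    unfolding Dm by (auto split: move.splits)
  have fst_Ds: "fst ` Ds \<subseteq> range rel_name"
    unfolding Ds by (auto split: option.splits)
  have "consistent Dm"
    unfolding consistent_def Dm by (auto split: move.splits if_splits)
  moreover have "consistent Ds"
    unfolding consistent_def Ds by (auto split: option.splits simp: inj_map_eq_map inj_def)
  moreover have "{pos_name, neg_name} \<inter> range rel_name = {}" by auto
  then have "fst ` Dm \<inter> fst ` Ds = {}"
    using Int_mono[OF fst_Dm fst_Ds] by (simp only: subset_empty)
  ultimately have consistent_DmDs: "consistent (Dm \<union> Ds)" by (rule consistent_Un)
  have "{ctrl_name, tape_name} \<inter> ({pos_name, neg_name} \<union> range rel_name) = {}"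
    by auto
  then have disjoint: "{ctrl_name, tape_name} \<inter> fst ` (Dm \<union> Ds) = {}"
    using Int_mono[OF order_refl Un_mono[OF fst_Dm fst_Ds], of "{ctrl_name, tape_name}"]
    by (simp only: subset_empty image_Un)
  have "consistent {(ctrl_name, [], a), (tape_name, xs, b)}" for xs :: "'a obj list" and a b
    by (auto simp: consistent_def)
  then show cons: "consistent D"
    unfolding D by (rule consistent_Un[OF _ consistent_DmDs]) (use disjoint in simp)
  have ctrl': "dyn (fire D A) ctrl_name [] = num (ctrl_code (out_ctrl i))"
    by (rule dyn_fire_in[OF cons]) (simp add: D)
  have tape': "dyn (fire D A) tape_name [num (nat z), num (nat (- z))] =
      num (sym_code (((tape c)(h := out_sym i)) z))" for z
  proof (cases "z = h")
    case True
    have "dyn (fire D A) tape_name [num (nat z), num (nat (- z))] = num (sym_code (out_sym i))"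
      by (rule dyn_fire_in[OF cons]) (simp add: D True)
    then show ?thesis using True by simp
  next
    case False
    \<comment> \<open>An integer is determined by its positive and negative parts, so the write does
      not affect any other cell.\<close>
    then have "\<not> (nat z = nat h \<and> nat (- z) = nat (- h))" by linarith
    then have "dyn (fire D A) tape_name [num (nat z), num (nat (- z))] =
        dyn A tape_name [num (nat z), num (nat (- z))]"
      using Dm_names Ds_names by (intro dyn_fire_notin) (fastforce simp: D)
    then show ?thesis using False tp by simp
  qed
  have halt': "dyn (fire D A) f [] = dyn A f []" if "f \<in> {Halt, Output}" for f
    using that Dm_names Ds_names by (intro dyn_fire_notin) (fastforce simp: D)
  have notin: "(f, [], b) \<notin> D" if "f \<in> {pos_name, neg_name}" "(f, [], b) \<notin> Dm" for f b
    using that Ds_names by (fastforce simp: D)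
  have pos': "dyn (fire D A) pos_name [] = num (nat (h + offset (out_move i)))"
  proof (cases "\<exists>b. (pos_name, [], b) \<in> Dm")
    case True
    then obtain b where b: "(pos_name, [], b) \<in> Dm" by blast
    then have "dyn (fire D A) pos_name [] = b" by (intro dyn_fire_in[OF cons]) (simp add: D)
    moreover have "b = num (nat (h + offset (out_move i)))"
      using b unfolding Dm by (auto split: move.splits if_splits simp: nat_add_distrib nat_diff_distrib')
    ultimately show ?thesis by simp
  next
    case False
    then have "dyn (fire D A) pos_name [] = num (nat h)"
      using notin pos by (subst dyn_fire_notin) auto
    \<comment> \<open>The head stays, or it moves right from a negative position and both sides are
      0.\<close>
    moreover have "nat h = nat (h + offset (out_move i))"
      using False unfolding Dm by (auto split: move.splits if_splits)
    ultimately show ?thesis by simp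
  qed
  have neg': "dyn (fire D A) neg_name [] = num (nat (- (h + offset (out_move i))))"
  proof (cases "\<exists>b. (neg_name, [], b) \<in> Dm")
    case True
    then obtain b where b: "(neg_name, [], b) \<in> Dm" by blast
    then have "dyn (fire D A) neg_name [] = b" by (intro dyn_fire_in[OF cons]) (simp add: D)
    moreover have "b = num (nat (- (h + offset (out_move i))))"
      using b unfolding Dm
      by (auto split: move.splits if_splits simp: Suc_nat_eq_nat_zadd1 simp flip: num.simps(2))
    ultimately show ?thesis by simp
  next
    case False
    then have "dyn (fire D A) neg_name [] = num (nat (- h))"
      using notin neg by (subst dyn_fire_notin) auto
    moreover have "nat (- h) = nat (- (h + offset (out_move i)))"
      using False unfolding Dm by (auto split: move.splits if_splits)
    ultimately show ?thesis by simp
  qed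
  define B where "B = rm_store_update (rm_vocab M) (out_op i) (store c)"
  have store': "store_rep (fire D A) B"
  proof -
    have U: "universe B = universe A"
      using store by (auto simp: B_def rm_store_update_def store_rep_def split: option.split)
    have "rel B r \<subseteq> tuples (universe A) k \<and>
        (\<forall>xs \<in> tuples (universe A) k. dyn (fire D A) (rel_name r) (map Atom xs) =
           truth ((xs \<in> rel B r) \<noteq> (r \<in> dom \<Upsilon>0 \<and> xs \<in> rel A r)))"
      if r: "rm_vocab M r = Some k" for r k
    proof (cases "\<exists>e. out_op i = Some (r, e)")
      case True
      then obtain e where e: "out_op i = Some (r, e)" by blast
      then have "op_ok (rm_vocab M) r e" using instr_ok[OF i] by (simp add: instr_ok_def)
      note sub = op_val_tuples[OF store this r]
      have B: "rel B r = op_val (rm_vocab M) (store c) e"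
        by (simp add: B_def rm_store_update_def e)
      show ?thesis
      proof (intro conjI ballI)
        show "rel B r \<subseteq> tuples (universe A) k" using sub B by simp
        fix xs assume "xs \<in> tuples (universe A) k"
        then show "dyn (fire D A) (rel_name r) (map Atom xs) =
            truth ((xs \<in> rel B r) \<noteq> (r \<in> dom \<Upsilon>0 \<and> xs \<in> rel A r))"
          using r by (intro dyn_fire_in[OF cons]) (simp add: D Ds e B)
      qed
    next
      case False
      then have "rel B r = rel (store c) r"
        by (auto simp: B_def rm_store_update_def split: option.split)
      \<comment> \<open>Injectivity of \<open>idx\<close> on the vocabulary separates
        \<open>r\<close> from the relation being assigned.\<close>
      moreover have "(rel_name r, xs, b) \<notin> D" for xs b
      proof -
        have "(rel_name r, xs, b) \<notin> Ds"
        proof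
          assume "(rel_name r, xs, b) \<in> Ds"
          then obtain k e where k: "out_op i = Some (k, e)" "rel_name k = rel_name r"
            unfolding Ds by (auto split: option.splits)
          then have "op_ok (rm_vocab M) k e" using instr_ok[OF i] by (simp add: instr_ok_def)
          then have "k \<in> dom (rm_vocab M)" by (cases e) auto
          then show False using rel_name_eq[of k r] r k False by auto
        qed
        then show ?thesis using Dm_names by (fastforce simp: D)
      qed
      ultimately show ?thesis
        using store r by (auto simp: dyn_fire_notin store_rep_def)
    qed
    then show ?thesis using U store by (simp add: store_rep_def)
  qed
  \<comment> \<open>A step adds at most one numeral, the incremented head counter; codes stay below
    \<open>code_bound\<close>, and store updates consist of atoms and Booleans.\<close>
  have within': "dyn_within (code_bound + Suc t) (fire D A)"
  proof (rule dyn_within_fire[OF within cons])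
    fix f xs b assume "(f, xs, b) \<in> D"
    then consider "xs = []" "b = num (ctrl_code (out_ctrl i))"
      | "xs = [num (nat h), num (nat (- h))]" "b = num (sym_code (out_sym i))"
      | "(f, xs, b) \<in> Dm" | "(f, xs, b) \<in> Ds"
      by (auto simp: D)
    then show "insert b (set xs) \<subseteq> small_objs (universe A) (code_bound + Suc t)"
    proof cases
      case 1
      then show ?thesis using code_bound[OF i] by auto
    next
      case 2
      then show ?thesis using code_bound[OF i] hd by auto
    next
      case 3
      then show ?thesis
        unfolding Dm using hd
        by (auto split: move.splits if_splits simp flip: num.simps(2))
    next
      case 4
      then obtain b' ys k where "xs = map Atom ys" "ys \<in> tuples (universe A) k" "b = truth b'"
        unfolding Ds by (auto split: option.splits)
      then show ?thesis
        using truth_in_small_objs[of "code_bound + Suc t" b' "universe A"]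
        by (auto simp: tuples_def)
    qed
  qed simp
  have "\<bar>h + offset (out_move i)\<bar> \<le> int (Suc t)"
    using hd by (cases "out_move i") auto
  then show "represents (Suc t) (fire D A) (rm_fire (rm_vocab M) i c)"
    using ctrl' tape' pos' neg' store' within' halt halt'
    by (simp add: represents_def rm_fire_def holds_def h_def B_def)
qed

section \<open>Steps, runs and halting\<close>

lemma represents_step:
  fixes A :: "('r, 'a) asm_state"
  assumes rep: "represents t A c" and step: "rm_step M c c'"
  shows "represents (Suc t) (sequel prog A) c'"
proof -
  obtain i where i: "i \<in> rm_instrs M" "c' = rm_fire (rm_vocab M) i c"
    and en: "enabled i (ctrl c) (tape c (head c)) (\<lambda>r. rel (store c) r = {})"
    and q: "ctrl c \<notin> rm_acc M \<union> rm_rej M"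
    using step by (auto simp: rm_step_def)
  define v where "v = (\<lambda>_ :: nat. zero :: 'a obj)"
  have "den prog A v = den (instr_rule i) A v"
    unfolding prog_def
  proof (rule den_switch)
    show "(guard i, instr_rule i) \<in> set prog_cases"
      using i en q by (auto simp: set_prog_cases enabled_def)
    show "val A v (guard i) = one"
      using val_guard[OF rep i(1)] en by simp
    fix g R assume "(g, R) \<in> set prog_cases" "val A v g = one"
    then obtain j where j: "j \<in> rm_instrs M" "R = instr_rule j" "val A v (guard j) = one"
      using q val_ctrl_guard[OF rep] by (auto simp: set_prog_cases)
    then have "enabled j (ctrl c) (tape c (head c)) (\<lambda>r. rel (store c) r = {})"
      using val_guard[OF rep] by simp
    \<comment> \<open>Determinism is what turns the ordered tests of \<open>switch\<close> into the
      choice made by \<open>rm_step\<close>.\<close>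
    then have "i = j" using en i(1) j(1) deterministic unfolding deterministic_def by blast
    then show "R = instr_rule i" using j by simp
  qed
  then show ?thesis
    using represents_fire[OF rep i(1), of v] i(2) by (simp add: sequel_def Let_def v_def)
qed

text \<open>The earlier states are tracked as well: activity is counted over the whole run, and
  \<open>Halt\<close> must fail until the end.\<close>

lemma represents_run:
  assumes "finite_structure \<Upsilon>0 I" "(rm_step M ^^ t) (rm_start \<Upsilon>0 M I) c"
  shows "represents t (state_at prog I t) c \<and>
    (\<forall>i \<le> t. \<exists>c'. represents i (state_at prog I i) c')"
  using assms(2)
proof (induction t arbitrary: c)
  case 0
  then show ?case using represents_initial[OF assms(1)] by (auto simp: state_at_def)
next
  case (Suc t)
  then obtain d where d: "(rm_step M ^^ t) (rm_start \<Upsilon>0 M I) d" "rm_step M d c" by auto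
  have "represents (Suc t) (state_at prog I (Suc t)) c"
    using represents_step[OF _ d(2)] Suc.IH[OF d(1)] by (simp add: state_at_def)
  then show ?case using Suc.IH[OF d(1)] by (auto simp: le_Suc_eq)
qed

text \<open>Here the control guard alone decides. Only \<open>Halt\<close> and possibly
  \<open>Output\<close> change, both to \<open>one\<close>, which the numeral bound already
  covers.\<close>

lemma sequel_halting:
  fixes A :: "('r, 'a) asm_state"
  assumes rep: "represents t A c" and q: "ctrl c \<in> rm_acc M \<union> rm_rej M"
  shows "holds (sequel prog A) Halt"
    "holds (sequel prog A) Output \<longleftrightarrow> ctrl c \<in> rm_acc M"
    "dyn_within (code_bound + Suc t) (sequel prog A)"
proof -
  define v where "v = (\<lambda>_ :: nat. zero :: 'a obj)"
  define D where
    "D = {(Halt, [] :: 'a obj list, one :: 'a obj)} \<union>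
      (if ctrl c \<in> rm_acc M then {(Output, [], one)} else {})"
  let ?R = "if ctrl c \<in> rm_acc M then acc_rule else rej_rule"
  have "den prog A v = den ?R A v"
    unfolding prog_def
  proof (rule den_switch)
    show "(ctrl_guard (ctrl c), ?R) \<in> set prog_cases"
      using q by (auto simp: set_prog_cases)
    show "val A v (ctrl_guard (ctrl c)) = one"
      using val_ctrl_guard[OF rep] by simp
    \<comment> \<open>The other halting rule is excluded by disjointness of the accepting and
      rejecting states, the instructions by the filter in \<open>prog_cases\<close>.\<close>
    fix g R assume "(g, R) \<in> set prog_cases" "val A v g = one"
    then show "R = ?R"
      using q acc_rej_disjoint val_ctrl_guard[OF rep] val_guard[OF rep]
      by (auto simp: set_prog_cases enabled_def)
  qed
  also have "\<dots> = D"
    by (auto simp: acc_rule_def rej_rule_def D_def den_par)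
  finally have den: "den prog A v = D" .
  have cons: "consistent D" by (auto simp: consistent_def D_def)
  have seq: "sequel prog A = fire D A"
    using den cons by (simp add: sequel_def Let_def v_def)
  show "holds (sequel prog A) Halt"
    unfolding seq holds_def by (rule dyn_fire_in[OF cons]) (simp add: D_def)
  show "holds (sequel prog A) Output \<longleftrightarrow> ctrl c \<in> rm_acc M"
  proof (cases "ctrl c \<in> rm_acc M")
    case True
    then show ?thesis
      unfolding seq holds_def using dyn_fire_in[OF cons, of Output "[]" one A] by (simp add: D_def)
  next
    case False
    then have "dyn (fire D A) Output [] = dyn A Output []"
      by (intro dyn_fire_notin) (simp add: D_def)
    then show ?thesis
      using False rep by (simp add: seq holds_def represents_def)
  qed
  have "one \<in> small_objs (universe A) (code_bound + Suc t)"
    using truth_in_small_objs[of "code_bound + Suc t" True "universe A"] by (simp add: truth_def)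
  then show "dyn_within (code_bound + Suc t) (sequel prog A)"
    using rep unfolding seq represents_def
    by (intro dyn_within_fire[OF _ cons, of "code_bound + t"]) (auto simp: D_def split: if_splits)
qed

text \<open>The additional step is the halting one. After \<open>Suc t\<close> steps
  \<open>small_objs\<close> has at most n + (\<open>code_bound\<close> + t + 2) members for input
  size n, and t is at most the value of \<open>p\<close> at n.\<close>

definition sim_program :: "int poly \<Rightarrow> 'r ptime_asm" where
  "sim_program p =
     \<lparr>pa_vocab = asm_voc, pa_prog = prog, pa_steps = p + 1,
      pa_space = p + [:int code_bound + 2, 1:]\<rparr>"

lemma ptime_program_sim: "ptime_program \<Upsilon>0 (sim_program p)"
  by (simp add: ptime_program_def sim_program_def vocab_ok_voc program_prog)

lemma ptime_run_sim:
  assumes I: "finite_structure \<Upsilon>0 I" and run: "(rm_step M ^^ t) (rm_start \<Upsilon>0 M I) c"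
    and q: "ctrl c \<in> rm_acc M \<union> rm_rej M" and t: "int t \<le> poly p (int (size_of I))"
  shows "ptime_run (sim_program p) I (Suc t)"
    "holds (state_at prog I (Suc t)) Halt"
    "holds (state_at prog I (Suc t)) Output \<longleftrightarrow> ctrl c \<in> rm_acc M"
proof -
  have rep: "represents t (state_at prog I t) c"
    and reps: "\<And>i. i \<le> t \<Longrightarrow> \<exists>c'. represents i (state_at prog I i) c'"
    using represents_run[OF I run] by auto
  have Suc: "state_at prog I (Suc t) = sequel prog (state_at prog I t)"
    by (simp add: state_at_def)
  show halt: "holds (state_at prog I (Suc t)) Halt"
    "holds (state_at prog I (Suc t)) Output \<longleftrightarrow> ctrl c \<in> rm_acc M"
    using sequel_halting[OF rep q] by (simp_all add: Suc)
  let ?U = "small_objs (universe I) (code_bound + Suc t)"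
  have "dyn_within (code_bound + Suc t) (state_at prog I i)" if "i \<le> Suc t" for i
  proof (cases "i = Suc t")
    case True
    then show ?thesis using sequel_halting(3)[OF rep q] by (simp add: Suc)
  next
    case False
    then have "i \<le> t" using that by simp
    then show ?thesis
      using reps[of i] dyn_within_mono[of "code_bound + i" _ "code_bound + Suc t"]
      by (auto simp: represents_def)
  qed
  then have act: "active asm_voc (state_at prog I i) \<subseteq> ?U" if "i \<le> Suc t" for i
    using active_small_objs[of "code_bound + Suc t" "state_at prog I i" asm_voc] that by simp
  define Act where "Act = (\<Union>i \<le> Suc t. active asm_voc (state_at prog I i))"
  have sub: "Act \<subseteq> ?U" using act unfolding Act_def by blast
  have fin: "finite (universe I)" using I by (simp add: finite_structure_def)
  have "card Act \<le> card (universe I) + Suc (code_bound + Suc t)"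
    using card_mono[OF finite_small_objs[OF fin] sub] card_small_objs[OF fin] le_trans by blast
  then have "int (card Act) \<le> poly p (int (size_of I)) + (int code_bound + 2 + int (size_of I))"
    using t unfolding size_of_def by linarith
  moreover have "finite Act" using sub finite_small_objs[OF fin] finite_subset by blast
  moreover have "run_segment prog I (Suc t)"
    using reps by (auto simp: run_segment_def represents_def less_Suc_eq_le)
  ultimately have "bounded_segment (sim_program p) I (Suc t)"
    using t unfolding bounded_segment_def Let_def sim_program_def
    by (simp add: Act_def[symmetric])
  \<comment> \<open>A longer segment would continue past index \<open>Suc t\<close>, where
    \<open>Halt\<close> holds.\<close>
  moreover have "m \<le> Suc t" if "bounded_segment (sim_program p) I m" for m
    using that halt(1)
    by (auto simp: bounded_segment_def sim_program_def run_segment_def not_le)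
      (metis not_less_eq_eq not_le)
  ultimately show "ptime_run (sim_program p) I (Suc t)"
    unfolding ptime_run_def by blast
qed

end

theorem theorem6:
  fixes \<Upsilon>0 :: "'r vocab" and \<Xi> :: "'r ptime_rm"
  assumes "ptime_relational_machine \<Upsilon>0 \<Xi>"
  shows "\<exists>P :: 'r ptime_asm. ptime_program \<Upsilon>0 P \<and>
           (\<forall>I :: ('r, 'a) struct. finite_structure \<Upsilon>0 I \<longrightarrow>
              (rm_accepts \<Upsilon>0 \<Xi> I \<longrightarrow> asm_accepts P I) \<and>
              (rm_rejects \<Upsilon>0 \<Xi> I \<longrightarrow> asm_rejects P I))"
proof -
  define M where "M = prm_machine \<Xi>"
  have M: "relational_machine \<Upsilon>0 M"
    using assms by (simp add: ptime_relational_machine_def M_def)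
  then have "finite (dom (rm_vocab M))" "finite (rm_instrs M)"
    by (auto simp: relational_machine_def)
  then obtain idx :: "'r \<Rightarrow> nat" and instrs
    where "inj_on idx (dom (rm_vocab M))" "set instrs = rm_instrs M"
    using finite_imp_inj_to_nat_seg finite_list by metis
  with M interpret machine_simulation \<Upsilon>0 M idx instrs
    by unfold_locales
  let ?P = "sim_program (prm_bound \<Xi>)"
  have P: "pa_prog ?P = prog" by (simp add: sim_program_def)
  have "(rm_accepts \<Upsilon>0 \<Xi> I \<longrightarrow> asm_accepts ?P I) \<and> (rm_rejects \<Upsilon>0 \<Xi> I \<longrightarrow> asm_rejects ?P I)"
    if I: "finite_structure \<Upsilon>0 I" for I :: "('r, 'a) struct"
  proof (intro conjI impI)
    assume "rm_accepts \<Upsilon>0 \<Xi> I"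
    then obtain t c where "int t \<le> poly (prm_bound \<Xi>) (int (size_of I))"
      "(rm_step M ^^ t) (rm_start \<Upsilon>0 M I) c" "ctrl c \<in> rm_acc M"
      by (auto simp: rm_accepts_def M_def)
    then show "asm_accepts ?P I"
      using ptime_run_sim[OF I] unfolding asm_accepts_def P by blast
  next
    assume "rm_rejects \<Upsilon>0 \<Xi> I"
    then obtain t c where "int t \<le> poly (prm_bound \<Xi>) (int (size_of I))"
      "(rm_step M ^^ t) (rm_start \<Upsilon>0 M I) c" "ctrl c \<in> rm_rej M"
      by (auto simp: rm_rejects_def M_def)
    then show "asm_rejects ?P I"
      using ptime_run_sim[OF I] acc_rej_disjoint unfolding asm_rejects_def P by blast
  qed
  then show ?thesis using ptime_program_sim by blast
qed

end
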